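(* Let $\mathcal R=\mathbb Z$ and $\vec m=(a,b)\in\mathbb Z^2$ ($L=1$) with $\gcd(a,b)=1$, and let $\sigma=a+b$. For every pair of finite CW-complexes $(X,B)$ and every $n\ge0$: (i) if $\{a,b\}=\{1,-1\}$, then ${}_{\vec m}\mathcal H_n(X,B)\cong\bigoplus_{k=0}^nH_k(X,B;\mathbb Z)$; (ii) if $\{a,b\}\neq\{1,-1\}$ (so $\sigma\neq0$), then ${}_{\vec m}\mathcal H_n(X,B)\cong\bigoplus_{0\le 2k\le n}H_{2k}(X,B;\mathbb Z_\sigma)$ if $n$ is even and ${}_{\vec m}\mathcal H_n(X,B)\cong\bigoplus_{0\le 2k+1\le n}H_{2k+1}(X,B;\mathbb Z_\sigma)$ if $n$ is odd, where $H_k(\,\cdot\,;G)$ is ordinary singular homology with coefficients in $G$ and $\mathbb Z_\sigma=\mathbb Z/\sigma\mathbb Z$.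
   Context: $\mathcal S_n(X)$ = continuous maps $[0,1]^n\to X$ ($[0,1]^0=\{0\}$), $\mathcal K_n(X)$ the free abelian group on $\mathcal S_n(X)$, $\mathcal K_{-1}(X)=0$. For $n\ge1$, $\langle T\rangle_{n,i,j}(x_1,\dots,x_{n-1})=T(x_1,\dots,x_{j-1},i,x_j,\dots,x_{n-1})$ for $i\in\{0,1\}$ ($\langle T\rangle_{1,i,1}(0)=T(i)$), $\partial_n(T)=\sum_{j=1}^n(-1)^{j+1}(a\langle T\rangle_{n,0,j}+b\langle T\rangle_{n,1,j})$ extended linearly, $\partial_0=0$. For a pair $(X,B)$, $\mathcal K_n(X,B)=\mathcal K_n(X)/\mathcal K_n(B)$ with the induced boundary, and ${}_{\vec m}\mathcal H_n(X,B)=\ker\partial_n/\operatorname{im}\partial_{n+1}$. *)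

theory Defs
  imports "HOL-Homology.Homology" "HOL-Algebra.Product_Groups"
begin

text \<open>The closed k-disc, its interior and its boundary sphere, realised inside
  nat => real (coordinates 0..k-1, all others zero), with the product topology
  (which on these finite-dimensional sets is the Euclidean topology).\<close>

definition disc :: "nat \<Rightarrow> (nat \<Rightarrow> real) set" where
  "disc k = {x. (\<forall>i\<ge>k. x i = 0) \<and> (\<Sum>i<k. (x i)^2) \<le> 1}"

definition open_disc :: "nat \<Rightarrow> (nat \<Rightarrow> real) set" where
  "open_disc k = {x. (\<forall>i\<ge>k. x i = 0) \<and> (\<Sum>i<k. (x i)^2) < 1}"

definition sphere_bd :: "nat \<Rightarrow> (nat \<Rightarrow> real) set" where
  "sphere_bd k = {x. (\<forall>i\<ge>k. x i = 0) \<and> (\<Sum>i<k. (x i)^2) = 1}"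

definition disc_top :: "nat \<Rightarrow> (nat \<Rightarrow> real) topology" where
  "disc_top k = subtopology (powertop_real UNIV) (disc k)"

text \<open>A finite CW structure on X: finitely many cells indexed by I, cell \<alpha> of
  dimension d \<alpha> with characteristic map \<Phi> \<alpha> : D^(d \<alpha>) \<rightarrow> X; the open cells
  partition X, each characteristic map is a homeomorphism of the open disc onto
  its open cell, and the boundary sphere lands in the union of lower-dimensional
  cells. (With finitely many cells and X Hausdorff, closure finiteness and the
  weak topology condition are automatic.)\<close>

definition CW_structure ::
  "'a topology \<Rightarrow> nat set \<Rightarrow> (nat \<Rightarrow> nat) \<Rightarrow> (nat \<Rightarrow> (nat \<Rightarrow> real) \<Rightarrow> 'a) \<Rightarrow> bool" where
  "CW_structure X I d \<Phi> \<longleftrightarrow>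
     Hausdorff_space X \<and> finite I \<and>
     (\<forall>\<alpha>\<in>I. continuous_map (disc_top (d \<alpha>)) X (\<Phi> \<alpha>)) \<and>
     (\<forall>\<alpha>\<in>I. homeomorphic_map (subtopology (disc_top (d \<alpha>)) (open_disc (d \<alpha>)))
                               (subtopology X (\<Phi> \<alpha> ` open_disc (d \<alpha>))) (\<Phi> \<alpha>)) \<and>
     disjoint_family_on (\<lambda>\<alpha>. \<Phi> \<alpha> ` open_disc (d \<alpha>)) I \<and>
     (\<Union>\<alpha>\<in>I. \<Phi> \<alpha> ` open_disc (d \<alpha>)) = topspace X \<and>
     (\<forall>\<alpha>\<in>I. \<Phi> \<alpha> ` sphere_bd (d \<alpha>) \<subseteq> (\<Union>\<beta>\<in>{\<beta>\<in>I. d \<beta> < d \<alpha>}. \<Phi> \<beta> ` open_disc (d \<beta>)))"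

definition finite_CW_pair :: "'a topology \<Rightarrow> 'a set \<Rightarrow> bool" where
  "finite_CW_pair X B \<longleftrightarrow>
     (\<exists>I d \<Phi> J. CW_structure X I d \<Phi> \<and> J \<subseteq> I \<and>
        B = (\<Union>\<alpha>\<in>J. \<Phi> \<alpha> ` open_disc (d \<alpha>)) \<and> closedin X B)"

definition standard_cube :: "nat \<Rightarrow> (nat \<Rightarrow> real) set" where
  "standard_cube n = {x. (\<forall>i<n. 0 \<le> x i \<and> x i \<le> 1) \<and> (\<forall>i\<ge>n. x i = 0)}"

text \<open>Singular n-cubes (coordinates x_1..x_n are x 0..x (n-1)), canonical outside the cube.\<close>
definition singular_cube :: "nat \<Rightarrow> 'a topology \<Rightarrow> ((nat \<Rightarrow> real) \<Rightarrow> 'a) \<Rightarrow> bool" where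
  "singular_cube n X T \<longleftrightarrow>
     continuous_map (subtopology (powertop_real UNIV) (standard_cube n)) X T
     \<and> T \<in> extensional (standard_cube n)"

text \<open>cube_face n i j T = <T>_{n,i,j}, for 1 \<le> j \<le> n: insert the value i at coordinate j.\<close>
definition cube_face :: "nat \<Rightarrow> real \<Rightarrow> nat \<Rightarrow> ((nat \<Rightarrow> real) \<Rightarrow> 'a) \<Rightarrow> (nat \<Rightarrow> real) \<Rightarrow> 'a" where
  "cube_face n i j T =
     restrict (\<lambda>x. T (\<lambda>k. if k < j - 1 then x k else if k = j - 1 then i else x (k - 1)))
              (standard_cube (n - 1))"

definition cube_chain :: "nat \<Rightarrow> 'a topology \<Rightarrow> 'a chain \<Rightarrow> bool" where
  "cube_chain n X c \<longleftrightarrow> Poly_Mapping.keys c \<subseteq> Collect (singular_cube n X)"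

definition cube_boundary :: "int \<Rightarrow> int \<Rightarrow> nat \<Rightarrow> 'a chain \<Rightarrow> 'a chain" where
  "cube_boundary a b n c =
     (if n = 0 then 0 else
      frag_extend (\<lambda>T. \<Sum>j\<in>{1..n}. frag_cmul ((-1) ^ (j + 1))
          (frag_cmul a (frag_of (cube_face n 0 j T)) + frag_cmul b (frag_of (cube_face n 1 j T)))) c)"

definition cube_group :: "nat \<Rightarrow> 'a topology \<Rightarrow> 'a chain monoid" where
  "cube_group n X = free_Abelian_group (Collect (singular_cube n X))"

definition cube_relcycle :: "int \<Rightarrow> int \<Rightarrow> nat \<Rightarrow> 'a topology \<Rightarrow> 'a set \<Rightarrow> 'a chain \<Rightarrow> bool" where
  "cube_relcycle a b n X B c \<longleftrightarrow>
     cube_chain n X c \<and> cube_chain (n - 1) (subtopology X B) (cube_boundary a b n c)"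

definition cube_relboundary :: "int \<Rightarrow> int \<Rightarrow> nat \<Rightarrow> 'a topology \<Rightarrow> 'a set \<Rightarrow> 'a chain \<Rightarrow> bool" where
  "cube_relboundary a b n X B c \<longleftrightarrow>
     (\<exists>d. cube_chain (Suc n) X d \<and> cube_chain n (subtopology X B) (c - cube_boundary a b (Suc n) d))"

definition cubical_homology :: "int \<Rightarrow> int \<Rightarrow> nat \<Rightarrow> 'a topology \<Rightarrow> 'a set \<Rightarrow> 'a chain set monoid" where
  "cubical_homology a b n X B =
     subgroup_generated (cube_group n X) (Collect (cube_relcycle a b n X B))
       Mod Collect (cube_relboundary a b n X B)"

text \<open>Relative singular chains with Z/sZ coefficients: C_p(X)/(C_p(B) + s C_p(X)).
  A chain is zero there iff it lies in C_p(B) + s C_p(X).\<close>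
definition zero_mod :: "int \<Rightarrow> nat \<Rightarrow> 'a topology \<Rightarrow> 'a set \<Rightarrow> 'a chain \<Rightarrow> bool" where
  "zero_mod s p X B c \<longleftrightarrow>
     (\<exists>u v. singular_chain p (subtopology X B) u \<and> singular_chain p X v \<and> c = u + frag_cmul s v)"

definition relcycle_mod :: "int \<Rightarrow> nat \<Rightarrow> 'a topology \<Rightarrow> 'a set \<Rightarrow> 'a chain \<Rightarrow> bool" where
  "relcycle_mod s p X B c \<longleftrightarrow>
     singular_chain p X c \<and> zero_mod s (p - 1) X B (chain_boundary p c)"

definition relboundary_mod :: "int \<Rightarrow> nat \<Rightarrow> 'a topology \<Rightarrow> 'a set \<Rightarrow> 'a chain \<Rightarrow> bool" where
  "relboundary_mod s p X B c \<longleftrightarrow>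
     (\<exists>d. singular_chain (Suc p) X d \<and> zero_mod s p X B (c - chain_boundary (Suc p) d))"

definition homology_mod :: "int \<Rightarrow> nat \<Rightarrow> 'a topology \<Rightarrow> 'a set \<Rightarrow> 'a chain set monoid" where
  "homology_mod s p X B =
     subgroup_generated (chain_group p X) (Collect (relcycle_mod s p X B))
       Mod Collect (relboundary_mod s p X B)"

end

theory Submission imports Defs begin

text \<open>Put \<open>\<sigma> = a + b\<close> and choose \<open>u\<close>, \<open>t\<close> with \<open>u b = 1 + t \<sigma>\<close>, which is possible since \<open>gcd a b = 1\<close>.
  The 1-chain \<open>\<theta> = u [id] + (t - u) [0] - t [1]\<close> of the unit interval then has weighted boundary
  \<open>[1] - [0]\<close> and becomes 0 in a point. Weighted cubical chains are multiplicative, so pushing the powers of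
  \<open>\<theta>\<close> forward along the cubes underlying singular simplices, and multiplying with constant cubes, gives a
  natural chain map \<open>f\<close> from \<open>S(X) \<otimes> K(point)\<close> to \<open>K(X)\<close>, where \<open>S\<close> denotes singular simplicial
  chains and \<open>K(point)\<close> has one generator in each degree with boundary alternately \<open>0\<close> and \<open>\<sigma>\<close>.
  The mapping cone of \<open>f\<close> is free on cubes and simplices and acyclic on convex sets; by acyclic models it is
  naturally contractible, so \<open>f\<close> is a homology isomorphism for every pair. The homology of
  \<open>S(X,B) \<otimes> K(point)\<close> is the sum of the shifted copies of \<open>H(X,B)\<close> if \<open>\<sigma> = 0\<close>, and otherwise of the
  shifts by even degrees of the mapping cones of \<open>\<sigma>\<close> on \<open>S(X,B)\<close>, that is, of homology with
  coefficients in \<open>\<int>/\<sigma>\<close>.\<close>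

section \<open>Cubical chains and weighted faces\<close>

text \<open>Constant cubes are not divided out and may have nonzero boundary, and the two ends of an
  ordinary prism enter its boundary as \<open>a\<close> times one plus \<open>b\<close> times the
  other instead of as a difference. The chain \<theta> repairs exactly this. The weighted boundary
  of x [id] + y [0] + z [1] is (x a + y \<sigma>) [0] + (x b + z \<sigma>) [1]. Asking for the
  coefficient 1 at [1] gives x b + z \<sigma> = 1, solvable because b and \<sigma> are coprime;
  imposing x + y + z = 0 then forces the coefficient -1 at [0] and makes \<theta> vanish in a point.
  The mapping cone replaces an inverse of f together with two homotopies by one contraction. Since
  the contraction is natural, it maps chains of B to chains of B, which gives the relative case at
  once, without long exact sequences. For \<sigma> \<noteq> 0 the group S(X,B) is free, so
  multiplication by \<sigma> is injective on it. Hence in a cycle of the total complex the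
  components of one parity determine those of the other, modulo chains of B, through division by
  \<sigma>; only the components with n - k even survive in homology.\<close>

lemma additive_eq_on_frag:
  fixes f g :: "('k \<Rightarrow>\<^sub>0 int) \<Rightarrow> 'b::ab_group_add"
  assumes f: "\<And>x y. f (x - y) = f x - f y" and g: "\<And>x y. g (x - y) = g x - g y"
    and eq: "\<And>k. k \<in> Poly_Mapping.keys c \<Longrightarrow> f (frag_of k) = g (frag_of k)"
  shows "f c = g c"
proof -
  have "f 0 = 0" "g 0 = 0"
    using f[of 0 0] g[of 0 0] by auto
  then show ?thesis
    by (induction rule: frag_induction[OF order_refl]) (auto simp: f g eq)
qed

lemma frag_cmul_diff: "frag_cmul c (x - y) = frag_cmul c x - frag_cmul c y"
  by (rule poly_mapping_eqI) (simp add: lookup_minus right_diff_distrib)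

definition cube_ins :: "nat \<Rightarrow> real \<Rightarrow> (nat \<Rightarrow> real) \<Rightarrow> nat \<Rightarrow> real" where
  "cube_ins j v x = (\<lambda>k. if k < j then x k else if k = j then v else x (k - 1))"

text \<open>The face at \<open>v\<close> in direction \<open>j\<close> followed by the degeneracy in
  that direction. The terms [0] and [1] of \<theta> act on a cube in this way.\<close>

definition cube_set :: "nat \<Rightarrow> nat \<Rightarrow> real \<Rightarrow> ((nat \<Rightarrow> real) \<Rightarrow> 'a) \<Rightarrow> (nat \<Rightarrow> real) \<Rightarrow> 'a" where
  "cube_set n j v T = restrict (\<lambda>x. T (x(j := v))) (standard_cube n)"

lemma cube_face_Suc:
  "cube_face (Suc n) v (Suc j) T = restrict (\<lambda>x. T (cube_ins j v x)) (standard_cube n)"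
  by (simp add: cube_face_def cube_ins_def cong: if_cong)

lemma cube_ins_in_cube:
  assumes "x \<in> standard_cube n" "j \<le> n" "0 \<le> v" "v \<le> 1"
  shows "cube_ins j v x \<in> standard_cube (Suc n)"
  using assms by (auto simp: standard_cube_def cube_ins_def)

lemma upd_in_cube:
  assumes "x \<in> standard_cube n" "j < n" "0 \<le> v" "v \<le> 1"
  shows "x(j := v) \<in> standard_cube n"
  using assms by (auto simp: standard_cube_def)

lemma cube_ins_ins:
  assumes "i < j"
  shows "cube_ins j w (cube_ins i v x) = cube_ins i v (cube_ins (j - 1) w x)"
  using assms by (auto simp: cube_ins_def fun_eq_iff)

lemma cube_face_face:
  assumes "i < j" "j \<le> Suc n" "v \<in> {0,1}" "w \<in> {0,1}"
  shows "cube_face (Suc n) v (Suc i) (cube_face (Suc (Suc n)) w (Suc j) T)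
       = cube_face (Suc n) w (Suc (j - 1)) (cube_face (Suc (Suc n)) v (Suc i) T)"
proof -
  have "cube_ins i v x \<in> standard_cube (Suc n)" "cube_ins (j - 1) w x \<in> standard_cube (Suc n)"
    if "x \<in> standard_cube n" for x
    using assms that by (auto intro!: cube_ins_in_cube)
  then show ?thesis
    unfolding cube_face_Suc by (simp add: restrict_def cube_ins_ins[OF assms(1)] cong: if_cong)
qed

lemma cube_face_set_less:
  assumes "i < j" "j \<le> n" "v \<in> {0,1}" "w \<in> {0,1}"
  shows "cube_face (Suc n) w (Suc j) (cube_set (Suc n) i v T)
       = cube_set n i v (cube_face (Suc n) w (Suc j) T)"
proof -
  have "cube_ins j w x \<in> standard_cube (Suc n)" "x(i := v) \<in> standard_cube n"
    if "x \<in> standard_cube n" for x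
    using assms that by (auto intro!: cube_ins_in_cube upd_in_cube)
  moreover have "(cube_ins j w x)(i := v) = cube_ins j w (x(i := v))" for x
    using assms by (auto simp: cube_ins_def fun_eq_iff)
  ultimately show ?thesis
    by (auto simp: cube_face_Suc cube_set_def restrict_def)
qed

lemma cube_face_set_greater:
  assumes "j < i" "i \<le> n" "v \<in> {0,1}" "w \<in> {0,1}"
  shows "cube_face (Suc n) w (Suc j) (cube_set (Suc n) i v T)
       = cube_set n (i - 1) v (cube_face (Suc n) w (Suc j) T)"
proof -
  have "cube_ins j w x \<in> standard_cube (Suc n)" "x(i - 1 := v) \<in> standard_cube n"
    if "x \<in> standard_cube n" for x
    using assms that by (auto intro!: cube_ins_in_cube upd_in_cube)
  moreover have "(cube_ins j w x)(i := v) = cube_ins j w (x(i - 1 := v))" for x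
    using assms by (auto simp: cube_ins_def fun_eq_iff)
  ultimately show ?thesis
    using assms by (auto simp: cube_face_Suc cube_set_def restrict_def)
qed

text \<open>The inserted value is overwritten at once, so both faces in direction \<open>j\<close>
  coincide. This is how the weights \<open>a\<close> and \<open>b\<close> add up to \<sigma> on
  cubes that are constant in one direction.\<close>

lemma cube_face_set_same:
  assumes "j \<le> n" "v \<in> {0,1}" "w \<in> {0,1}"
  shows "cube_face (Suc n) w (Suc j) (cube_set (Suc n) j v T) = cube_face (Suc n) v (Suc j) T"
proof -
  have "cube_ins j w x \<in> standard_cube (Suc n)" if "x \<in> standard_cube n" for x
    using assms that by (auto intro!: cube_ins_in_cube)
  moreover have "(cube_ins j w x)(j := v) = cube_ins j v x" for x
    using assms by (auto simp: cube_ins_def fun_eq_iff)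
  ultimately show ?thesis
    by (auto simp: cube_face_Suc cube_set_def restrict_def)
qed

lemma cube_set_commute:
  assumes "i \<noteq> j" "i < n" "j < n" "v \<in> {0,1}" "w \<in> {0,1}"
  shows "cube_set n i v (cube_set n j w T) = cube_set n j w (cube_set n i v T)"
proof -
  have "x(i := v) \<in> standard_cube n" "x(j := w) \<in> standard_cube n" if "x \<in> standard_cube n" for x
    using assms that by (auto intro!: upd_in_cube)
  then show ?thesis
    using assms by (auto simp: cube_set_def restrict_def fun_upd_twist)
qed

text \<open>Faces are extended to chains with 0-based coordinate index \<open>j\<close>.\<close>

definition cface :: "nat \<Rightarrow> real \<Rightarrow> nat \<Rightarrow> 'a chain \<Rightarrow> 'a chain" where
  "cface n v j = frag_extend (\<lambda>T. frag_of (cube_face (Suc n) v (Suc j) T))"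

lemma cface_of [simp]: "cface n v j (frag_of T) = frag_of (cube_face (Suc n) v (Suc j) T)"
  and cface_0 [simp]: "cface n v j 0 = 0"
  and cface_add: "cface n v j (x + y) = cface n v j x + cface n v j y"
  and cface_diff: "cface n v j (x - y) = cface n v j x - cface n v j y"
  and cface_cmul: "cface n v j (frag_cmul k x) = frag_cmul k (cface n v j x)"
  by (simp_all add: cface_def frag_extend_add frag_extend_diff frag_extend_cmul)

lemma cface_cface:
  assumes "i < j" "j \<le> Suc n" "v \<in> {0,1}" "w \<in> {0,1}"
  shows "cface n v i (cface (Suc n) w j c) = cface n w (j - 1) (cface (Suc n) v i c)"
  by (rule additive_eq_on_frag[of "\<lambda>c. cface n v i (cface (Suc n) w j c)" "\<lambda>c. cface n w (j - 1) (cface (Suc n) v i c)"])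
     (use assms in \<open>simp_all add: cface_diff cube_face_face del: One_nat_def\<close>)

text \<open>The usual cancellation: the pair (j, i) with i < j is matched with (i, j - 1), which
  lies in the other half of the square, has the same value of \<open>G\<close> and the opposite
  sign.\<close>

lemma alternating_double_sum_eq_0:
  fixes G :: "nat \<Rightarrow> nat \<Rightarrow> 'k \<Rightarrow>\<^sub>0 int"
  assumes G: "\<And>i j. i < j \<Longrightarrow> j \<le> n \<Longrightarrow> G i j = G (j - 1) i"
  shows "(\<Sum>j\<le>n. \<Sum>i<n. frag_cmul ((-1) ^ (i + j)) (G i j)) = 0"
proof -
  let ?g = "\<lambda>(j,i). frag_cmul ((-1) ^ (i + j)) (G i j)"
  let ?A = "{(j,i). j \<le> n \<and> i < n \<and> i < j}" and ?B = "{(j,i). j \<le> n \<and> i < n \<and> j \<le> i}"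
  have fin: "finite ?A" "finite ?B"
    by (rule finite_subset[of _ "{..n} \<times> {..n}"]; auto)+
  have "(\<Sum>j\<le>n. \<Sum>i<n. frag_cmul ((-1) ^ (i + j)) (G i j)) = sum ?g ({..n} \<times> {..<n})"
    by (simp add: sum.cartesian_product)
  also have "{..n} \<times> {..<n} = ?A \<union> ?B"
    by auto
  also have "sum ?g (?A \<union> ?B) = sum ?g ?A + sum ?g ?B"
    by (rule sum.union_disjoint[OF fin]) auto
  also have "sum ?g ?A = sum (\<lambda>p. - ?g p) ?B"
  proof (rule sum.reindex_bij_witness[of _ "\<lambda>(j,i). (Suc i, j)" "\<lambda>(j,i). (i, j - 1)"])
    fix p assume p: "p \<in> ?A"
    obtain j i where ji: "p = (j,i)" by fastforce
    with p have "i < j" "j \<le> n" by auto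
    then have "(-1::int) ^ (i + j) = - ((-1) ^ (j - 1 + i))"
      by (cases j) (auto simp: add.commute)
    then show "- ?g (case p of (j, i) \<Rightarrow> (i, j - 1)) = ?g p"
      using ji G[OF \<open>i < j\<close> \<open>j \<le> n\<close>] by simp
  qed auto
  finally show ?thesis
    by (simp add: sum_negf)
qed

lemma cube_boundary_Suc:
  "cube_boundary a b (Suc n) c =
     (\<Sum>j\<le>n. frag_cmul ((-1) ^ j) (frag_cmul a (cface n 0 j c) + frag_cmul b (cface n 1 j c)))"
proof (rule additive_eq_on_frag[of "cube_boundary a b (Suc n)"])
  fix T
  have "{1..Suc n} = Suc ` {..n}"
    by (simp add: image_Suc_atMost)
  then show "cube_boundary a b (Suc n) (frag_of T) =
     (\<Sum>j\<le>n. frag_cmul ((-1) ^ j) (frag_cmul a (cface n 0 j (frag_of T)) + frag_cmul b (cface n 1 j (frag_of T))))"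
    by (simp add: cube_boundary_def sum.reindex)
qed (simp_all add: cube_boundary_def frag_extend_diff cface_diff frag_cmul_diff
    frag_cmul_distrib2 sum.distrib sum_subtractf)

lemma cube_boundary_0 [simp]: "cube_boundary a b 0 c = 0"
  by (simp add: cube_boundary_def)

lemma cube_boundary_diff: "cube_boundary a b n (x - y) = cube_boundary a b n x - cube_boundary a b n y"
  and cube_boundary_add: "cube_boundary a b n (x + y) = cube_boundary a b n x + cube_boundary a b n y"
  and cube_boundary_zero [simp]: "cube_boundary a b n 0 = 0"
  and cube_boundary_cmul: "cube_boundary a b n (frag_cmul k x) = frag_cmul k (cube_boundary a b n x)"
  by (simp_all add: cube_boundary_def frag_extend_diff frag_extend_add frag_extend_cmul)

lemma cube_boundary_boundary: "cube_boundary a b n (cube_boundary a b (Suc n) c) = 0"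
proof (cases n)
  case (Suc m)
  \<comment> \<open>Combining the two weighted faces of each direction into one operator turns the
    cubical relations into relations of simplicial shape, so the usual alternating cancellation
    applies.\<close>
  define W where "W n j c = frag_cmul a (cface n 0 j c) + frag_cmul b (cface n 1 j c)" for n j and c :: "'a chain"
  have W_cmul: "W n j (frag_cmul k c) = frag_cmul k (W n j c)" for n j k c
    by (rule poly_mapping_eqI) (simp add: W_def cface_cmul lookup_add algebra_simps)
  have W_sum: "W n j (sum f I) = (\<Sum>i\<in>I. W n j (f i))" for n j I and f :: "nat \<Rightarrow> 'a chain"
    by (induction I rule: infinite_finite_induct)
       (auto simp: W_def cface_add frag_cmul_distrib2 algebra_simps)
  have WW: "W m i (W n j c) = W m (j - 1) (W n i c)" if "i < j" "j \<le> n" for i j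
    using that Suc
    by (intro poly_mapping_eqI)
       (simp add: W_def cface_cmul cface_add cface_cface lookup_add algebra_simps)
  have B: "cube_boundary a b (Suc n) c = (\<Sum>j\<le>n. frag_cmul ((-1) ^ j) (W n j c))" for n c
    by (simp add: cube_boundary_Suc W_def)
  have "cube_boundary a b n (cube_boundary a b (Suc n) c) =
    (\<Sum>i<n. \<Sum>j\<le>n. frag_cmul ((-1) ^ (i + j)) (W m i (W n j c)))"
  proof -
    have "cube_boundary a b n d = (\<Sum>i<n. frag_cmul ((-1) ^ i) (W m i d))" for d
      using B[of m d] Suc by (simp add: lessThan_Suc_atMost)
    then show ?thesis
      by (simp only: B[of n] W_sum W_cmul frag_cmul_sum power_add frag_cmul_cmul)
  qed
  also have "\<dots> = (\<Sum>j\<le>n. \<Sum>i<n. frag_cmul ((-1) ^ (i + j)) (W m i (W n j c)))"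
    by (rule sum.swap)
  also have "\<dots> = 0"
    by (rule alternating_double_sum_eq_0) (use WW in auto)
  finally show ?thesis .
qed simp

text \<open>Domains of cubes and of simplices are both subsets of
  \<open>nat \<Rightarrow> real\<close>, so one coordinatewise criterion serves faces,
  \<open>cube_set\<close>, \<open>simplex_cube\<close> and the prism.\<close>

lemma continuous_map_restrict_compose:
  fixes g :: "(nat \<Rightarrow> real) \<Rightarrow> nat \<Rightarrow> real"
  assumes "continuous_map (subtopology (powertop_real UNIV) D) X T"
    and "g \<in> D' \<rightarrow> D"
    and "\<And>i. continuous_map (subtopology (powertop_real UNIV) D') euclideanreal (\<lambda>x. g x i)"
  shows "continuous_map (subtopology (powertop_real UNIV) D') X (restrict (\<lambda>x. T (g x)) D')"
proof -
  have "continuous_map (subtopology (powertop_real UNIV) D') (subtopology (powertop_real UNIV) D) g"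
    using assms by (auto simp: continuous_map_in_subtopology continuous_map_componentwise)
  from continuous_map_compose[OF this assms(1)]
  have "continuous_map (subtopology (powertop_real UNIV) D') X (\<lambda>x. T (g x))"
    by (simp add: o_def)
  then show ?thesis
    by (rule continuous_map_eq) auto
qed

lemma continuous_map_coordinate:
  "continuous_map (subtopology (powertop_real UNIV) D) euclideanreal (\<lambda>x. x i)"
  by (intro continuous_map_from_subtopology continuous_map_product_projection) auto

lemma singular_cube_face:
  assumes "singular_cube (Suc n) X T" "j \<le> n" "v \<in> {0,1}"
  shows "singular_cube n X (cube_face (Suc n) v (Suc j) T)"
proof -
  have "continuous_map (subtopology (powertop_real UNIV) (standard_cube n)) euclideanreal (\<lambda>x. cube_ins j v x i)" for i
    by (auto simp: cube_ins_def intro: continuous_map_coordinate)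
  moreover have "cube_ins j v \<in> standard_cube n \<rightarrow> standard_cube (Suc n)"
    using assms by (auto intro!: cube_ins_in_cube)
  ultimately show ?thesis
    using assms unfolding singular_cube_def cube_face_Suc
    by (intro conjI continuous_map_restrict_compose[where D="standard_cube (Suc n)"]) simp_all
qed

lemma singular_cube_set:
  assumes "singular_cube n X T" "j < n" "v \<in> {0,1}"
  shows "singular_cube n X (cube_set n j v T)"
proof -
  have "continuous_map (subtopology (powertop_real UNIV) (standard_cube n)) euclideanreal (\<lambda>x. (x(j := v)) i)" for i
    by (cases "i = j") (auto intro: continuous_map_coordinate)
  moreover have "(\<lambda>x. x(j := v)) \<in> standard_cube n \<rightarrow> standard_cube n"
    using assms by (auto intro!: upd_in_cube)
  ultimately show ?thesis
    using assms unfolding singular_cube_def cube_set_def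
    by (intro conjI continuous_map_restrict_compose[where D="standard_cube n"]) blast+
qed

lemma cube_chain_0 [simp]: "cube_chain n X 0"
  and cube_chain_of [simp]: "cube_chain n X (frag_of T) \<longleftrightarrow> singular_cube n X T"
  and cube_chain_cmul: "cube_chain n X c \<Longrightarrow> cube_chain n X (frag_cmul k c)"
  by (auto simp: cube_chain_def)

lemma cube_chain_add: "cube_chain n X c \<Longrightarrow> cube_chain n X d \<Longrightarrow> cube_chain n X (c + d)"
  unfolding cube_chain_def using keys_add[of c d] by blast

lemma cube_chain_diff: "cube_chain n X c \<Longrightarrow> cube_chain n X d \<Longrightarrow> cube_chain n X (c - d)"
  unfolding cube_chain_def using keys_diff[of c d] by blast

lemma cube_chain_minus: "cube_chain n X c \<Longrightarrow> cube_chain n X (- c)"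
  unfolding cube_chain_def by simp

lemma cube_chain_sum: "(\<And>i. i \<in> I \<Longrightarrow> cube_chain n X (f i)) \<Longrightarrow> cube_chain n X (sum f I)"
  by (induction I rule: infinite_finite_induct) (auto simp: cube_chain_add)

lemma cube_chain_extend:
  "(\<And>T. T \<in> Poly_Mapping.keys c \<Longrightarrow> cube_chain n X (f T)) \<Longrightarrow> cube_chain n X (frag_extend f c)"
  by (simp add: frag_extend_def cube_chain_cmul cube_chain_sum)

lemma cube_chain_cface:
  "cube_chain (Suc n) X c \<Longrightarrow> j \<le> n \<Longrightarrow> v \<in> {0,1} \<Longrightarrow> cube_chain n X (cface n v j c)"
  unfolding cface_def by (rule cube_chain_extend) (auto simp: cube_chain_def intro: singular_cube_face)

lemma cube_chain_boundary:
  "cube_chain n X c \<Longrightarrow> cube_chain (n - 1) X (cube_boundary a b n c)"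
  by (cases n) (auto simp: cube_boundary_Suc
      intro!: cube_chain_sum cube_chain_cmul cube_chain_add cube_chain_cface)

section \<open>Multiplication of coordinate directions by \<theta>\<close>

locale cubical_weights =
  fixes a b u t :: int
  assumes weights: "u * b = 1 + t * (a + b)"
begin

text \<open>The coefficients are chosen so that the weighted faces of \<open>thick\<close> in direction \<open>j\<close> combine to the
  difference of the faces at 1 and 0, and so that cubes not depending on coordinate \<open>j\<close> are killed.\<close>

definition thick :: "nat \<Rightarrow> nat \<Rightarrow> 'a chain \<Rightarrow> 'a chain" where
  "thick n j = frag_extend (\<lambda>T. frag_cmul u (frag_of T) + frag_cmul (t - u) (frag_of (cube_set n j 0 T))
       - frag_cmul t (frag_of (cube_set n j 1 T)))"

lemma thick_of: "thick n j (frag_of T) = frag_cmul u (frag_of T)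
    + frag_cmul (t - u) (frag_of (cube_set n j 0 T)) - frag_cmul t (frag_of (cube_set n j 1 T))"
  and thick_0 [simp]: "thick n j 0 = 0"
  and thick_add: "thick n j (x + y) = thick n j x + thick n j y"
  and thick_diff: "thick n j (x - y) = thick n j x - thick n j y"
  and thick_cmul: "thick n j (frag_cmul k x) = frag_cmul k (thick n j x)"
  by (simp_all add: thick_def frag_extend_add frag_extend_diff frag_extend_cmul)

lemma cube_chain_thick: "cube_chain n X c \<Longrightarrow> j < n \<Longrightarrow> cube_chain n X (thick n j c)"
  unfolding thick_def
  by (auto simp: cube_chain_def[of _ _ c] intro!: cube_chain_extend cube_chain_diff cube_chain_add
       cube_chain_cmul singular_cube_set)

lemma cface_thick_less:
  assumes "i < j" "j \<le> n" "w \<in> {0,1}"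
  shows "cface n w j (thick (Suc n) i c) = thick n i (cface n w j c)"
  by (rule additive_eq_on_frag[of "\<lambda>c. cface n w j (thick (Suc n) i c)" "\<lambda>c. thick n i (cface n w j c)"])
     (use assms in \<open>simp_all add: cface_diff thick_diff thick_of cface_cmul cface_add cube_face_set_less\<close>)

lemma cface_thick_greater:
  assumes "j < i" "i \<le> n" "w \<in> {0,1}"
  shows "cface n w j (thick (Suc n) i c) = thick n (i - 1) (cface n w j c)"
  by (rule additive_eq_on_frag[of "\<lambda>c. cface n w j (thick (Suc n) i c)" "\<lambda>c. thick n (i - 1) (cface n w j c)"])
     (use assms in \<open>simp_all add: cface_diff thick_diff thick_of cface_cmul cface_add cube_face_set_greater\<close>)

lemma thick_commute:
  assumes "i \<noteq> j" "i < n" "j < n"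
  shows "thick n i (thick n j c) = thick n j (thick n i c)"
proof (rule additive_eq_on_frag[of _ _ c])
  fix T show "thick n i (thick n j (frag_of T)) = thick n j (thick n i (frag_of T))"
    using assms
    by (intro poly_mapping_eqI)
      (simp add: thick_of thick_add thick_diff thick_cmul cube_set_commute[of i j] lookup_add lookup_minus algebra_simps)
qed (simp_all add: thick_diff)

text \<open>The face at 1 receives the coefficient u b - t \<sigma> = 1, by the choice of
  \<open>u\<close> and \<open>t\<close>. The face at 0 receives u a + (t - u) \<sigma> = t \<sigma>
  - u b = -1.\<close>

lemma wface_thick_same:
  assumes "j \<le> n"
  shows "frag_cmul a (cface n 0 j (thick (Suc n) j c)) + frag_cmul b (cface n 1 j (thick (Suc n) j c))
       = cface n 1 j c - cface n 0 j c"
proof (rule additive_eq_on_frag[of _ _ c])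
  fix T
  have tb: "b * u - b * t - a * t = 1"
    using weights by (simp add: algebra_simps)
  show "frag_cmul a (cface n 0 j (thick (Suc n) j (frag_of T))) + frag_cmul b (cface n 1 j (thick (Suc n) j (frag_of T)))
       = cface n 1 j (frag_of T) - cface n 0 j (frag_of T)" 
  proof (rule poly_mapping_eqI)
    fix k
    define p q where "p = Poly_Mapping.lookup (frag_of (cube_face (Suc n) 0 (Suc j) T)) k"
      and "q = Poly_Mapping.lookup (frag_of (cube_face (Suc n) 1 (Suc j) T)) k"
    have "a * (u * p + (t - u) * p - t * q) + b * (u * q + (t - u) * p - t * q)
        = (b * u - b * t - a * t) * (q - p)"
      by (simp add: algebra_simps)
    also have "\<dots> = q - p"
      by (simp add: tb)
    finally have "a * (u * p + (t - u) * p - t * q) + b * (u * q + (t - u) * p - t * q) = q - p" .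
    then show "Poly_Mapping.lookup (frag_cmul a (cface n 0 j (thick (Suc n) j (frag_of T))) + frag_cmul b (cface n 1 j (thick (Suc n) j (frag_of T)))) k
       = Poly_Mapping.lookup (cface n 1 j (frag_of T) - cface n 0 j (frag_of T)) k"
      using assms by (simp add: thick_of cface_add cface_diff cface_cmul cube_face_set_same
        lookup_add lookup_minus del: lookup_frag_of flip: p_def q_def)
  qed
qed (simp_all add: cface_diff thick_diff frag_cmul_diff algebra_simps)

text \<open>The coefficients \<open>u\<close>, \<open>t - u\<close> and \<open>- t\<close> sum to 0,
  and here all three cubes in \<open>thick\<close> coincide.\<close>

lemma thick_degenerate:
  assumes "T \<in> extensional (standard_cube n)"
    and "\<And>x v. x \<in> standard_cube n \<Longrightarrow> v \<in> {0,1} \<Longrightarrow> T (x(j := v)) = T x"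
  shows "thick n j (frag_of T) = 0"
proof -
  have "cube_set n j v T = T" if "v \<in> {0,1}" for v
    using assms that by (auto simp: cube_set_def extensional_def restrict_def)
  then show ?thesis
    by (intro poly_mapping_eqI) (simp add: thick_of lookup_add lookup_minus algebra_simps)
qed

text \<open>The pushforward of the \<open>k\<close>-th power of \<theta> in the first
  \<open>k\<close> coordinates. The other coordinates are left alone to make room for a constant
  cube as second factor.\<close>

fun thicks :: "nat \<Rightarrow> nat \<Rightarrow> 'a chain \<Rightarrow> 'a chain" where
  "thicks n 0 c = c"
| "thicks n (Suc k) c = thick n k (thicks n k c)"

lemma thicks_0 [simp]: "thicks n k 0 = 0"
  and thicks_diff: "thicks n k (x - y) = thicks n k x - thicks n k y"
  by (induction k) (simp_all add: thick_diff)

lemma cube_chain_thicks: "cube_chain n X c \<Longrightarrow> k \<le> n \<Longrightarrow> cube_chain n X (thicks n k c)"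
  by (induction k) (auto simp: cube_chain_thick)

lemma thick_thicks_commute: "k \<le> i \<Longrightarrow> i < n \<Longrightarrow> thick n i (thicks n k c) = thicks n k (thick n i c)"
  by (induction k) (auto simp: thick_commute)

lemma cface_thicks_ge:
  "k \<le> j \<Longrightarrow> j \<le> n \<Longrightarrow> w \<in> {0,1} \<Longrightarrow> cface n w j (thicks (Suc n) k c) = thicks n k (cface n w j c)"
  by (induction k) (auto simp: cface_thick_less)

text \<open>The operators in directions other than \<open>j\<close> commute with the face, up to a
  shift of the index, and the one in direction \<open>j\<close> is consumed by
  \<open>wface_thick_same\<close>; hence \<open>k - 1\<close> operators remain.\<close>

lemma wface_thicks_less:
  assumes "j < k" "k \<le> Suc n"
  shows "frag_cmul a (cface n 0 j (thicks (Suc n) k c)) + frag_cmul b (cface n 1 j (thicks (Suc n) k c))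
       = thicks n (k - 1) (cface n 1 j c - cface n 0 j c)"
  using assms
proof (induction k)
  case (Suc k)
  show ?case
  proof (cases "j = k")
    case True
    with Suc.prems show ?thesis
      by (simp add: wface_thick_same cface_thicks_ge thicks_diff)
  next
    case False
    with Suc.prems obtain k' where k': "k = Suc k'" "j \<le> k'"
      by (cases k) auto
    then show ?thesis
      using Suc False
      by (simp add: cface_thick_greater flip: thick_cmul thick_add)
  qed
qed simp

text \<open>Thickenings in different directions commute, so the one in direction \<open>j\<close>
  may be applied to \<open>c\<close> before the others.\<close>

lemma thicks_degenerate:
  assumes "j < k" "k \<le> n" "thick n j c = 0"
  shows "thicks n k c = 0"
  using assms
proof (induction k)
  case (Suc k)
  then show ?case
    by (cases "j = k") (auto simp: thick_thicks_commute)
qed simp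

end

section \<open>From simplices to cubes\<close>

definition cube_map :: "nat \<Rightarrow> ('a \<Rightarrow> 'b) \<Rightarrow> 'a chain \<Rightarrow> 'b chain" where
  "cube_map n g = frag_extend (\<lambda>T. frag_of (restrict (g \<circ> T) (standard_cube n)))"

lemma cube_map_of [simp]: "cube_map n g (frag_of T) = frag_of (restrict (g \<circ> T) (standard_cube n))"
  and cube_map_0 [simp]: "cube_map n g 0 = 0"
  and cube_map_add: "cube_map n g (x + y) = cube_map n g x + cube_map n g y"
  and cube_map_diff: "cube_map n g (x - y) = cube_map n g x - cube_map n g y"
  and cube_map_cmul: "cube_map n g (frag_cmul k x) = frag_cmul k (cube_map n g x)"
  by (simp_all add: cube_map_def frag_extend_add frag_extend_diff frag_extend_cmul)

lemma cube_map_sum: "cube_map n g (sum f I) = (\<Sum>i\<in>I. cube_map n g (f i))"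
  by (induction I rule: infinite_finite_induct) (auto simp: cube_map_add)

lemma cface_cube_map:
  assumes "j \<le> n" "v \<in> {0,1}"
  shows "cface n v j (cube_map (Suc n) g c) = cube_map n g (cface n v j c)"
proof -
  have "cube_ins j v x \<in> standard_cube (Suc n)" if "x \<in> standard_cube n" for x
    using assms that by (auto intro!: cube_ins_in_cube)
  then have "cube_face (Suc n) v (Suc j) (restrict (g \<circ> T) (standard_cube (Suc n)))
      = restrict (g \<circ> cube_face (Suc n) v (Suc j) T) (standard_cube n)" for T
    by (auto simp: cube_face_Suc restrict_def)
  then show ?thesis
    by (intro additive_eq_on_frag[of "\<lambda>c. cface n v j (cube_map (Suc n) g c)" "\<lambda>c. cube_map n g (cface n v j c)" c])
       (simp_all add: cface_diff cube_map_diff)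
qed

lemma cube_boundary_cube_map:
  "cube_boundary a b n (cube_map n g c) = cube_map (n - 1) g (cube_boundary a b n c)"
  by (cases n) (simp_all add: cube_boundary_Suc cface_cube_map cube_map_sum cube_map_add cube_map_cmul
    del: sum.atMost_Suc)

text \<open>The iterated cone parametrisation of the simplex by the cube. Its faces at 1 and its last face
  at 0 are the faces of the simplex; the other faces at 0 do not depend on the last coordinate.\<close>

definition cube_to_simplex :: "nat \<Rightarrow> (nat \<Rightarrow> real) \<Rightarrow> nat \<Rightarrow> real" where
  "cube_to_simplex k x i =
     (if i < k then (\<Prod>l<i. x l) * (1 - x i) else if i = k then (\<Prod>l<k. x l) else 0)"

lemma prod_cube_ins:
  "(\<Prod>l<i. cube_ins j v x l) = (if i \<le> j then (\<Prod>l<i. x l) else v * (\<Prod>l<i - 1. x l))"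
proof (induction i)
  case (Suc i)
  show ?case
  proof (cases "i \<le> j")
    case True
    with Suc show ?thesis by (cases "i = j") (auto simp: cube_ins_def)
  next
    case False
    then obtain i' where "i = Suc i'" by (cases i) auto
    with Suc False show ?thesis by (auto simp: cube_ins_def)
  qed
qed simp

text \<open>The barycentric coordinates telescope: the first m of them sum to 1 minus the product of
  the first m cube coordinates, and the last vertex receives the remaining product.\<close>

lemma cube_to_simplex_in:
  assumes "x \<in> standard_cube n" "k \<le> n"
  shows "cube_to_simplex k x \<in> standard_simplex k"
proof -
  have x: "0 \<le> x i" "x i \<le> 1" for i
    using assms by (auto simp: standard_cube_def) (metis leI order_refl zero_le_one)+
  have P: "0 \<le> (\<Prod>l<i. x l)" "(\<Prod>l<i. x l) \<le> 1" for i
    using x by (auto intro: prod_nonneg prod_le_1)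
  have "(\<Sum>i<m. (\<Prod>l<i. x l) * (1 - x i)) = 1 - (\<Prod>l<m. x l)" for m
    by (induction m) (auto simp: algebra_simps)
  then have "(\<Sum>i\<le>k. cube_to_simplex k x i) = 1"
    by (simp add: cube_to_simplex_def flip: lessThan_Suc_atMost)
  then show ?thesis
    using x P by (auto simp: standard_simplex_def cube_to_simplex_def intro: mult_le_one)
qed

lemma cube_to_simplex_ins_1:
  assumes "j \<le> k"
  shows "cube_to_simplex (Suc k) (cube_ins j 1 x) = simplical_face j (cube_to_simplex k x)"
proof
  fix i
  show "cube_to_simplex (Suc k) (cube_ins j 1 x) i = simplical_face j (cube_to_simplex k x) i"
    using assms unfolding cube_to_simplex_def simplical_face_def prod_cube_ins
    by (auto simp: cube_ins_def)
qed

lemma cube_to_simplex_ins_0: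
  "cube_to_simplex (Suc k) (cube_ins k 0 x) = simplical_face (Suc k) (cube_to_simplex k x)"
proof
  fix i
  consider "i < k" | "i = k" | "i = Suc k" | "i > Suc k"
    by linarith
  then show "cube_to_simplex (Suc k) (cube_ins k 0 x) i = simplical_face (Suc k) (cube_to_simplex k x) i"
    unfolding cube_to_simplex_def simplical_face_def prod_cube_ins
    by cases (auto simp: cube_ins_def)
qed

lemma cube_to_simplex_ins_0_less:
  assumes "j < k"
  shows "cube_to_simplex (Suc k) (cube_ins j 0 (x(k - 1 := v))) = cube_to_simplex (Suc k) (cube_ins j 0 x)"
proof
  fix i
  have "(\<Prod>l<i. (x(k - 1 := v)) l) = (\<Prod>l<i. x l)" if "i \<le> j" for i
    using assms that by (intro prod.cong) auto
  then show "cube_to_simplex (Suc k) (cube_ins j 0 (x(k - 1 := v))) i = cube_to_simplex (Suc k) (cube_ins j 0 x) i"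
    using assms unfolding cube_to_simplex_def prod_cube_ins
    by (auto simp: cube_ins_def)
qed

lemma cube_to_simplex_ins_ge: "k \<le> j \<Longrightarrow> cube_to_simplex k (cube_ins j v x) = cube_to_simplex k x"
  by (auto simp: cube_to_simplex_def prod_cube_ins fun_eq_iff cube_ins_def)

text \<open>For \<open>k \<le> n\<close> the last \<open>n - k\<close> coordinates are ignored. This
  encodes the product of a \<open>k\<close>-simplex with the constant \<open>(n - k)\<close>-cube,
  so that S(X) \<otimes> K(point) is handled without a tensor product.\<close>

definition simplex_cube :: "nat \<Rightarrow> nat \<Rightarrow> ((nat \<Rightarrow> real) \<Rightarrow> 'a) \<Rightarrow> (nat \<Rightarrow> real) \<Rightarrow> 'a" where
  "simplex_cube n k s = restrict (\<lambda>x. s (cube_to_simplex k x)) (standard_cube n)"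

lemma cube_face_simplex_cube_1:
  assumes "j \<le> k" "k \<le> n"
  shows "cube_face (Suc n) 1 (Suc j) (simplex_cube (Suc n) (Suc k) s)
       = simplex_cube n k (singular_face (Suc k) j s)"
  using assms
  by (auto simp: cube_face_Suc simplex_cube_def singular_face_def restrict_def
      cube_ins_in_cube cube_to_simplex_in cube_to_simplex_ins_1)

lemma cube_face_simplex_cube_0:
  assumes "k \<le> n"
  shows "cube_face (Suc n) 0 (Suc k) (simplex_cube (Suc n) (Suc k) s)
       = simplex_cube n k (singular_face (Suc k) (Suc k) s)"
  using assms
  by (auto simp: cube_face_Suc simplex_cube_def singular_face_def restrict_def
      cube_ins_in_cube cube_to_simplex_in cube_to_simplex_ins_0)

lemma cube_face_simplex_cube_ge:
  assumes "k \<le> j" "j \<le> n" "v \<in> {0,1}"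
  shows "cube_face (Suc n) v (Suc j) (simplex_cube (Suc n) k s) = simplex_cube n k s"
proof -
  have "cube_ins j v x \<in> standard_cube (Suc n)" if "x \<in> standard_cube n" for x
    using assms that by (auto intro!: cube_ins_in_cube)
  then show ?thesis
    using assms by (auto simp: cube_face_Suc simplex_cube_def restrict_def cube_to_simplex_ins_ge)
qed

lemma singular_cube_simplex_cube:
  assumes "singular_simplex k X s" "k \<le> n"
  shows "singular_cube n X (simplex_cube n k s)"
proof -
  have "continuous_map (subtopology (powertop_real UNIV) (standard_cube n)) euclideanreal
          (\<lambda>x. cube_to_simplex k x i)" for i
    unfolding cube_to_simplex_def
    by (cases "i < k"; cases "i = k")
       (auto intro!: continuous_map_real_mult continuous_map_prod continuous_map_diff continuous_map_coordinate)
  moreover have "cube_to_simplex k \<in> standard_cube n \<rightarrow> standard_simplex k"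
    using assms cube_to_simplex_in by auto
  ultimately show ?thesis
    using assms unfolding singular_cube_def simplex_cube_def singular_simplex_def
    by (intro conjI continuous_map_restrict_compose[where D="standard_simplex k"]) blast+
qed

text \<open>The directions k, ..., n of a cube that ignores them all contribute the same face, with
  these signs; hence \<sigma> appears only when their number is odd.\<close>

lemma alternating_sum_from:
  assumes "k \<le> Suc n"
  shows "(\<Sum>j=k..n. (-1::int) ^ j) = (if odd (Suc n - k) then (-1) ^ k else 0)"
proof -
  have "(\<Sum>j=k..<k + d. (-1::int) ^ j) = (if odd d then (-1) ^ k else 0)" for d
    by (induction d) (auto simp: power_add)
  from this[of "Suc n - k"] show ?thesis
    using assms by (simp add: atLeastLessThanSuc_atLeastAtMost)
qed

context cubical_weights
begin

lemma thick_cube_map: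
  assumes "j < n"
  shows "thick n j (cube_map n g c) = cube_map n g (thick n j c)"
proof -
  have "x(j := v) \<in> standard_cube n" if "x \<in> standard_cube n" "v \<in> {0,1}" for x v
    using assms that by (auto intro!: upd_in_cube)
  then have "cube_set n j v (restrict (g \<circ> T) (standard_cube n))
      = restrict (g \<circ> cube_set n j v T) (standard_cube n)" if "v \<in> {0,1}" for v T
    using that by (auto simp: cube_set_def restrict_def)
  then show ?thesis
    by (intro additive_eq_on_frag[of "\<lambda>c. thick n j (cube_map n g c)" "\<lambda>c. cube_map n g (thick n j c)" c])
       (simp_all add: thick_diff cube_map_diff thick_of cube_map_add cube_map_cmul)
qed

lemma thicks_cube_map: "k \<le> n \<Longrightarrow> thicks n k (cube_map n g c) = cube_map n g (thicks n k c)"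
  by (induction k) (auto simp: thick_cube_map)

text \<open>The comparison map f on the summand of S(X) \<otimes> K(point) given by
  \<open>k\<close>-simplices and the constant \<open>(n - k)\<close>-cube.\<close>

definition simp_to_cube :: "nat \<Rightarrow> nat \<Rightarrow> 'a chain \<Rightarrow> 'a chain" where
  "simp_to_cube n k = frag_extend (\<lambda>s. thicks n k (frag_of (simplex_cube n k s)))"

lemma simp_to_cube_of: "simp_to_cube n k (frag_of s) = thicks n k (frag_of (simplex_cube n k s))"
  and simp_to_cube_0 [simp]: "simp_to_cube n k 0 = 0"
  and simp_to_cube_add: "simp_to_cube n k (x + y) = simp_to_cube n k x + simp_to_cube n k y"
  and simp_to_cube_diff: "simp_to_cube n k (x - y) = simp_to_cube n k x - simp_to_cube n k y"
  and simp_to_cube_cmul: "simp_to_cube n k (frag_cmul m x) = frag_cmul m (simp_to_cube n k x)"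
  by (simp_all add: simp_to_cube_def frag_extend_add frag_extend_diff frag_extend_cmul)

lemma simp_to_cube_sum: "simp_to_cube n k (sum f I) = (\<Sum>i\<in>I. simp_to_cube n k (f i))"
  by (induction I rule: infinite_finite_induct) (auto simp: simp_to_cube_add)

lemma cube_chain_simp_to_cube:
  "singular_chain k X c \<Longrightarrow> k \<le> n \<Longrightarrow> cube_chain n X (simp_to_cube n k c)"
  unfolding simp_to_cube_def
  by (rule cube_chain_extend)
     (auto simp: singular_chain_def intro!: cube_chain_thicks singular_cube_simplex_cube)

lemma simp_to_cube_chain_map:
  assumes "k \<le> n"
  shows "simp_to_cube n k (chain_map k g c) = cube_map n g (simp_to_cube n k c)"
proof -
  have "simplex_cube n k (simplex_map k g s) = restrict (g \<circ> simplex_cube n k s) (standard_cube n)" for s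
    using assms by (auto simp: simplex_cube_def simplex_map_def restrict_def cube_to_simplex_in)
  then show ?thesis
    using assms
    by (intro additive_eq_on_frag[of "\<lambda>c. simp_to_cube n k (chain_map k g c)" "\<lambda>c. cube_map n g (simp_to_cube n k c)" c])
       (simp_all add: simp_to_cube_diff chain_map_diff cube_map_diff simp_to_cube_of thicks_cube_map flip: cube_map_of)
qed

text \<open>Thickening turns the weighted faces into the face at 1 minus the face at 0. The former
  is the simplicial face \<open>j\<close>. The latter ignores its last thickened coordinate and
  dies, except in direction \<open>k\<close>, where it is the last simplicial face.\<close>

lemma wface_simp_to_cube_less:
  assumes "j \<le> k" "k \<le> n"
  shows "frag_cmul a (cface n 0 j (simp_to_cube (Suc n) (Suc k) (frag_of s)))
           + frag_cmul b (cface n 1 j (simp_to_cube (Suc n) (Suc k) (frag_of s)))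
       = simp_to_cube n k (frag_of (singular_face (Suc k) j s))
         - (if j = k then simp_to_cube n k (frag_of (singular_face (Suc k) (Suc k) s)) else 0)"
proof -
  let ?T = "simplex_cube (Suc n) (Suc k) s"
  have "thicks n k (frag_of (cube_face (Suc n) 0 (Suc j) ?T)) = 0" if "j < k"
  proof (rule thicks_degenerate[where j="k - 1"])
    have "cube_face (Suc n) 0 (Suc j) ?T (x(k - 1 := v)) = cube_face (Suc n) 0 (Suc j) ?T x"
      if "x \<in> standard_cube n" "v \<in> {0,1}" for x v
      using that assms \<open>j < k\<close>
      by (auto simp: cube_face_Suc simplex_cube_def cube_to_simplex_ins_0_less cube_ins_in_cube
          upd_in_cube simp del: One_nat_def)
    then show "thick n (k - 1) (frag_of (cube_face (Suc n) 0 (Suc j) ?T)) = 0"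
      by (rule thick_degenerate[rotated]) (auto simp: cube_face_Suc simp del: restrict_apply)
  qed (use that assms in auto)
  then show ?thesis
    using assms
    by (auto simp: simp_to_cube_of wface_thicks_less thicks_diff cube_face_simplex_cube_1 cube_face_simplex_cube_0
        simp del: thicks.simps(2))
qed

text \<open>Compatibility of f with boundaries: the thickened directions give the simplicial
  boundary, while each of the remaining directions gives \<sigma> times one and the same chain, with
  alternating signs starting at \<open>(-1) ^ k\<close>.\<close>

lemma cube_boundary_simp_to_cube:
  assumes "k \<le> Suc n"
  shows "cube_boundary a b (Suc n) (simp_to_cube (Suc n) k c) =
     simp_to_cube n (k - 1) (chain_boundary k c)
      + (if odd (Suc n - k) then frag_cmul ((-1) ^ k * (a + b)) (simp_to_cube n k c) else 0)"
proof (rule additive_eq_on_frag[of "\<lambda>c. cube_boundary a b (Suc n) (simp_to_cube (Suc n) k c)"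
        "\<lambda>c. simp_to_cube n (k - 1) (chain_boundary k c)
      + (if odd (Suc n - k) then frag_cmul ((-1) ^ k * (a + b)) (simp_to_cube n k c) else 0)" c])
  fix s
  define W where "W j = frag_cmul a (cface n 0 j (simp_to_cube (Suc n) k (frag_of s)))
           + frag_cmul b (cface n 1 j (simp_to_cube (Suc n) k (frag_of s)))" for j
  define g where "g j = frag_cmul ((-1) ^ j) (W j)" for j
  have "cube_boundary a b (Suc n) (simp_to_cube (Suc n) k (frag_of s)) = sum g {..n}"
    unfolding cube_boundary_Suc by (rule sum.cong) (simp_all add: W_def g_def)
  also have "{..n} = {..<k} \<union> {k..n}"
    using assms by auto
  also have "sum g ({..<k} \<union> {k..n}) = sum g {..<k} + sum g {k..n}"
    by (rule sum.union_disjoint) auto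
  also have "sum g {k..n} = (if odd (Suc n - k) then frag_cmul ((-1) ^ k * (a + b)) (simp_to_cube n k (frag_of s)) else 0)"
  proof -
    have "g j = frag_cmul ((-1) ^ j) (frag_cmul (a + b) (simp_to_cube n k (frag_of s)))" if "j \<in> {k..n}" for j
      using that
      by (simp add: g_def W_def simp_to_cube_of cface_thicks_ge cube_face_simplex_cube_ge frag_cmul_distrib distrib_left)
    then have "sum g {k..n} = frag_cmul (\<Sum>j=k..n. (-1) ^ j) (frag_cmul (a + b) (simp_to_cube n k (frag_of s)))"
      by (intro poly_mapping_eqI) (simp add: lookup_sum sum_distrib_right)
    then show ?thesis
      using alternating_sum_from[OF assms] by simp
  qed
  also have "sum g {..<k} = simp_to_cube n (k - 1) (chain_boundary k (frag_of s))"
  proof (cases k)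
    case (Suc m)
    define f where "f j = frag_cmul ((-1) ^ j) (simp_to_cube n m (frag_of (singular_face (Suc m) j s)))" for j
    \<comment> \<open>A simplex of dimension \<open>Suc m\<close> has one face more than there are
      thickened directions. Direction \<open>m\<close> supplies two of them: the minus sign at its
      face at 0 turns \<open>(-1) ^ m\<close> into the sign of the last face.\<close>
    have gf: "g j = f j + (if j = m then f (Suc m) else 0)" if "j \<le> m" for j
      using that Suc assms wface_simp_to_cube_less[of j m n s]
      by (simp add: g_def W_def f_def frag_cmul_diff)
    have "sum g {..<k} = sum g {..m}"
      using Suc by (simp add: lessThan_Suc_atMost)
    also have "\<dots> = (\<Sum>j\<le>m. f j + (if j = m then f (Suc m) else 0))"
      using gf by (intro sum.cong) auto
    also have "\<dots> = (\<Sum>j\<le>Suc m. f j)"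
      by (simp add: sum.distrib)
    also have "\<dots> = simp_to_cube n (k - 1) (chain_boundary k (frag_of s))"
      using Suc by (simp add: chain_boundary_of simp_to_cube_sum simp_to_cube_cmul f_def simp_to_cube_add)
    finally show ?thesis .
  qed (simp add: chain_boundary_def)
  finally show "cube_boundary a b (Suc n) (simp_to_cube (Suc n) k (frag_of s)) =
     simp_to_cube n (k - 1) (chain_boundary k (frag_of s))
      + (if odd (Suc n - k) then frag_cmul ((-1) ^ k * (a + b)) (simp_to_cube n k (frag_of s)) else 0)" .
qed (simp_all add: cube_boundary_diff simp_to_cube_diff chain_boundary_diff frag_cmul_diff)

end

section \<open>Contractions on convex models\<close>

text \<open>Convexity provides the straight lines for cones and prisms. The bound on the coordinates
  serves the continuity of cones at the apex.\<close>

definition convex_in_box :: "(nat \<Rightarrow> real) set \<Rightarrow> bool" where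
  "convex_in_box Y \<longleftrightarrow> (\<forall>x\<in>Y. \<forall>y\<in>Y. \<forall>r\<in>{0..1}. (\<lambda>i. (1 - r) * x i + r * y i) \<in> Y) \<and> (\<forall>x\<in>Y. \<forall>i. \<bar>x i\<bar> \<le> 1)"

lemma convex_in_boxD1:
  "convex_in_box Y \<Longrightarrow> x \<in> Y \<Longrightarrow> y \<in> Y \<Longrightarrow> 0 \<le> r \<Longrightarrow> r \<le> 1 \<Longrightarrow> (\<lambda>i. (1 - r) * x i + r * y i) \<in> Y"
  and convex_in_boxD2: "convex_in_box Y \<Longrightarrow> x \<in> Y \<Longrightarrow> \<bar>x i\<bar> \<le> 1"
  by (auto simp: convex_in_box_def)

lemma convex_in_box_cube: "convex_in_box (standard_cube n)"
proof -
  have "\<bar>x j\<bar> \<le> 1" if "x \<in> standard_cube n" for x j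
    using that by (cases "j < n") (auto simp: standard_cube_def)
  then show ?thesis
    by (auto simp: convex_in_box_def standard_cube_def intro!: convex_bound_le)
qed

lemma convex_in_box_simplex: "convex_in_box (standard_simplex k)"
  using convex_standard_simplex
  by (auto simp: convex_in_box_def standard_simplex_def abs_le_iff intro: order_trans[of _ 0])

text \<open>The join of \<open>s\<close> with the apex \<open>y\<close>, placed at vertex 0. At
  \<open>x 0 = 1\<close> the division by zero is harmless, since the factor \<open>1 - x 0\<close>
  removes the value of \<open>s\<close>.\<close>

definition coned_simplex :: "(nat \<Rightarrow> real) \<Rightarrow> nat \<Rightarrow> ((nat \<Rightarrow> real) \<Rightarrow> nat \<Rightarrow> real) \<Rightarrow> (nat \<Rightarrow> real) \<Rightarrow> nat \<Rightarrow> real" where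
  "coned_simplex y k s =
     restrict (\<lambda>x i. (1 - x 0) * s (\<lambda>l. x (Suc l) / (1 - x 0)) i + x 0 * y i) (standard_simplex (Suc k))"

lemma coned_simplex_base_in:
  assumes "x \<in> standard_simplex (Suc k)" "x 0 \<noteq> 1"
  shows "(\<lambda>l. x (Suc l) / (1 - x 0)) \<in> standard_simplex k"
proof -
  have x: "0 \<le> x i" "x i \<le> 1" for i
    using assms by (auto simp: standard_simplex_def)
  have sum: "x 0 + (\<Sum>l\<le>k. x (Suc l)) = 1"
    using assms by (simp add: standard_simplex_def sum.atMost_Suc_shift del: sum.atMost_Suc)
  have x0: "x 0 < 1"
    using x[of 0] assms(2) by linarith
  have "x (Suc l) \<le> 1 - x 0" if "l \<le> k" for l
    using member_le_sum[of l "{..k}" "\<lambda>l. x (Suc l)"] x sum that by auto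
  moreover have "x (Suc l) = 0" if "l > k" for l
    using that assms by (auto simp: standard_simplex_def)
  ultimately have "x (Suc l) \<le> 1 - x 0" for l
    using x0 by (cases "l \<le> k") auto
  moreover have "(\<Sum>l\<le>k. x (Suc l) / (1 - x 0)) = 1"
    using sum x0 by (simp flip: sum_divide_distrib)
  ultimately show ?thesis
    using assms x x0 by (auto simp: standard_simplex_def)
qed

text \<open>Away from the apex, on a relatively open set, the formula is a composition of continuous
  maps. At the apex the first summand is at most \<open>1 - x 0\<close> in absolute value, because
  the coordinates of \<open>Y\<close> are bounded by 1, and so it tends to 0.\<close>

lemma singular_coned_simplex:
  assumes s: "singular_simplex k (subtopology (powertop_real UNIV) Y) s"
    and Y: "convex_in_box Y"
    and y: "y \<in> Y"
  shows "singular_simplex (Suc k) (subtopology (powertop_real UNIV) Y) (coned_simplex y k s)"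
proof -
  let ?D = "standard_simplex (Suc k)"
  define g where "g x i = (1 - x 0) * s (\<lambda>l. x (Suc l) / (1 - x 0)) i + x 0 * y i" for x i
  have s_cont: "continuous_on (standard_simplex k) (\<lambda>x. s x i)" for i
  proof -
    have "continuous_map (subtopology (powertop_real UNIV) (standard_simplex k)) euclideanreal (\<lambda>x. s x i)"
      using s by (auto simp: singular_simplex_def continuous_map_in_subtopology continuous_map_componentwise)
    then show ?thesis
      by (simp add: euclidean_product_topology)
  qed
  have sY: "s x \<in> Y" if "x \<in> standard_simplex k" for x
    using s that by (auto simp: singular_simplex_def continuous_map_in_subtopology Pi_iff image_subset_iff)
  have coord: "continuous_on A (\<lambda>x::nat\<Rightarrow>real. x i)" for A i
    using continuous_map_coordinate[of A i] by (simp add: euclidean_product_topology)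
  have gY: "g x \<in> Y" if x: "x \<in> ?D" for x
  proof (cases "x 0 = 1")
    case True
    then have "g x = y"
      by (auto simp: g_def)
    then show ?thesis using y by simp
  next
    case False
    with x show ?thesis
      unfolding g_def
      by (intro convex_in_boxD1[OF Y] y sY coned_simplex_base_in) (auto simp: standard_simplex_def)
  qed
  have "continuous_on ?D (\<lambda>x. g x i)" for i
    unfolding continuous_on_def
  proof
    fix p assume p: "p \<in> ?D"
    have lim0: "((\<lambda>x::nat\<Rightarrow>real. x 0) \<longlongrightarrow> p 0) (at p within ?D)"
      using coord[of ?D 0] p by (auto simp: continuous_on_def)
    show "((\<lambda>x. g x i) \<longlongrightarrow> g p i) (at p within ?D)"
    proof (cases "p 0 = 1")
      case True
      have "((\<lambda>x. (1 - x 0) * s (\<lambda>l. x (Suc l) / (1 - x 0)) i) \<longlongrightarrow> 0) (at p within ?D)"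
      proof (rule Lim_null_comparison)
        have "norm ((1 - x 0) * s (\<lambda>l. x (Suc l) / (1 - x 0)) i) \<le> 1 - x 0" if "x \<in> ?D" for x
        proof (cases "x 0 = 1")
          case False
          have "\<bar>s (\<lambda>l. x (Suc l) / (1 - x 0)) i\<bar> \<le> 1"
            using False that by (intro convex_in_boxD2[OF Y] sY coned_simplex_base_in)
          moreover have "x 0 \<le> 1"
            using that by (auto simp: standard_simplex_def)
          ultimately show ?thesis
            by (simp add: abs_mult mult_left_le)
        qed simp
        then show "\<forall>\<^sub>F x in at p within ?D. norm ((1 - x 0) * s (\<lambda>l. x (Suc l) / (1 - x 0)) i) \<le> 1 - x 0"
          by (auto simp: eventually_at_filter)
        show "((\<lambda>x. 1 - x 0) \<longlongrightarrow> 0) (at p within ?D)"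
          using tendsto_diff[OF tendsto_const lim0, of 1] True by simp
      qed
      from tendsto_add[OF this tendsto_mult[OF lim0 tendsto_const[of "y i"]]]
      show ?thesis
        using True by (simp add: g_def)
    next
      case False
      let ?U = "{x::nat\<Rightarrow>real. x 0 \<noteq> 1}"
      have "open ?U"
        using open_Collect_neq[OF coord[of UNIV 0] continuous_on_const[of UNIV 1]] by simp
      have "continuous_on (?D \<inter> ?U) (\<lambda>x. \<lambda>l. x (Suc l) / (1 - x 0))"
        by (intro continuous_on_coordinatewise_then_product continuous_intros coord) auto
      moreover have "(\<lambda>x. \<lambda>l. x (Suc l) / (1 - x 0)) ` (?D \<inter> ?U) \<subseteq> standard_simplex k"
        using coned_simplex_base_in by auto
      ultimately have "continuous_on (?D \<inter> ?U) (\<lambda>x. s (\<lambda>l. x (Suc l) / (1 - x 0)) i)"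
        using continuous_on_compose2[OF s_cont] by blast
      then have "continuous_on (?D \<inter> ?U) (\<lambda>x. g x i)"
        unfolding g_def by (intro continuous_intros coord)
      then have "((\<lambda>x. g x i) \<longlongrightarrow> g p i) (at p within (?D \<inter> ?U))"
        using p False by (auto simp: continuous_on_def)
      moreover have "at p within (?D \<inter> ?U) = at p within ?D"
        by (rule at_within_nhd[where S="?U"]) (use False \<open>open ?U\<close> in auto)
      ultimately show ?thesis by simp
    qed
  qed
  then have "continuous_map (subtopology (powertop_real UNIV) ?D) euclideanreal (\<lambda>x. g x i)" for i
    by (simp add: euclidean_product_topology)
  then have "continuous_map (subtopology (powertop_real UNIV) ?D) (powertop_real UNIV) g"
    by (auto simp: continuous_map_componentwise)
  then have "continuous_map (subtopology (powertop_real UNIV) ?D) (subtopology (powertop_real UNIV) Y) g"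
    using gY by (auto simp: continuous_map_in_subtopology)
  then have "continuous_map (subtopology (powertop_real UNIV) ?D) (subtopology (powertop_real UNIV) Y) (coned_simplex y k s)"
    by (rule continuous_map_eq) (auto simp: coned_simplex_def g_def)
  then show ?thesis
    by (simp add: singular_simplex_def coned_simplex_def)
qed

lemma singular_face_0_coned_simplex:
  assumes "s \<in> extensional (standard_simplex k)"
  shows "singular_face (Suc k) 0 (coned_simplex y k s) = s"
proof
  fix x
  show "singular_face (Suc k) 0 (coned_simplex y k s) x = s x"
    using assms simplical_face_in_standard_simplex[of "Suc k" 0 x]
    by (auto simp: singular_face_def coned_simplex_def simplical_face_def extensional_def)
qed

lemma singular_face_Suc_coned_simplex:
  assumes "j \<le> Suc k"
  shows "singular_face (Suc (Suc k)) (Suc j) (coned_simplex y (Suc k) s)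
       = coned_simplex y k (singular_face (Suc k) j s)"
proof
  fix x
  show "singular_face (Suc (Suc k)) (Suc j) (coned_simplex y (Suc k) s) x
      = coned_simplex y k (singular_face (Suc k) j s) x"
  proof (cases "x \<in> standard_simplex (Suc k)")
    case True
    then have mem: "simplical_face (Suc j) x \<in> standard_simplex (Suc (Suc k))"
      using simplical_face_in_standard_simplex[of "Suc (Suc k)" "Suc j" x] assms by auto
    have 0: "simplical_face (Suc j) x 0 = x 0"
      by (simp add: simplical_face_def)
    have sh: "(\<lambda>l. simplical_face (Suc j) x (Suc l) / (1 - x 0)) = simplical_face j (\<lambda>l. x (Suc l) / (1 - x 0))"
    proof
      fix l show "simplical_face (Suc j) x (Suc l) / (1 - x 0) = simplical_face j (\<lambda>l. x (Suc l) / (1 - x 0)) l"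
        by (cases l) (auto simp: simplical_face_def)
    qed
    show ?thesis
    proof (cases "x 0 = 1")
      case False
      then have "(\<lambda>l. x (Suc l) / (1 - x 0)) \<in> standard_simplex k"
        using True by (intro coned_simplex_base_in)
      then show ?thesis
        using True mem by (simp add: singular_face_def coned_simplex_def 0 sh)
    qed (use True mem in \<open>simp add: singular_face_def coned_simplex_def 0\<close>)
  qed (simp add: singular_face_def coned_simplex_def)
qed

lemma singular_face_1_coned_simplex_0:
  "singular_face (Suc 0) (Suc 0) (coned_simplex y 0 s) = restrict (\<lambda>_. y) (standard_simplex 0)"
proof
  fix x
  show "singular_face (Suc 0) (Suc 0) (coned_simplex y 0 s) x = restrict (\<lambda>_. y) (standard_simplex 0) x"
    using simplical_face_in_standard_simplex[of "Suc 0" "Suc 0" x]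
    by (auto simp: singular_face_def coned_simplex_def simplical_face_def standard_simplex_0)
qed

definition chain_cone :: "(nat \<Rightarrow> real) \<Rightarrow> nat \<Rightarrow> (nat \<Rightarrow> real) chain \<Rightarrow> (nat \<Rightarrow> real) chain" where
  "chain_cone y k = frag_extend (\<lambda>s. frag_of (coned_simplex y k s))"

lemma chain_cone_of [simp]: "chain_cone y k (frag_of s) = frag_of (coned_simplex y k s)"
  and chain_cone_0 [simp]: "chain_cone y k 0 = 0"
  and chain_cone_add: "chain_cone y k (c + d) = chain_cone y k c + chain_cone y k d"
  and chain_cone_diff: "chain_cone y k (c - d) = chain_cone y k c - chain_cone y k d"
  and chain_cone_cmul: "chain_cone y k (frag_cmul m c) = frag_cmul m (chain_cone y k c)"
  by (simp_all add: chain_cone_def frag_extend_add frag_extend_diff frag_extend_cmul)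

lemma chain_cone_sum: "chain_cone y k (sum f I) = (\<Sum>i\<in>I. chain_cone y k (f i))"
  by (induction I rule: infinite_finite_induct) (auto simp: chain_cone_add)

lemma chain_boundary_cone_Suc:
  assumes "s \<in> extensional (standard_simplex (Suc k))"
  shows "chain_boundary (Suc (Suc k)) (frag_of (coned_simplex y (Suc k) s))
       = frag_of s - chain_cone y k (chain_boundary (Suc k) (frag_of s))"
proof -
  have "chain_boundary (Suc (Suc k)) (frag_of (coned_simplex y (Suc k) s))
      = (\<Sum>j\<le>Suc (Suc k). frag_cmul ((-1) ^ j) (frag_of (singular_face (Suc (Suc k)) j (coned_simplex y (Suc k) s))))"
    by (simp add: chain_boundary_of del: sum.atMost_Suc)
  also have "\<dots> = frag_of s + (\<Sum>j\<le>Suc k. frag_cmul ((-1) ^ Suc j) (frag_of (coned_simplex y k (singular_face (Suc k) j s))))"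
    using assms
    by (subst sum.atMost_Suc_shift) (simp add: singular_face_0_coned_simplex singular_face_Suc_coned_simplex del: sum.atMost_Suc)
  also have "\<dots> = frag_of s - (\<Sum>j\<le>Suc k. frag_cmul ((-1) ^ j) (frag_of (coned_simplex y k (singular_face (Suc k) j s))))"
    by (simp add: sum_negf[symmetric] del: sum.atMost_Suc flip: add_uminus_conv_diff)
  also have "\<dots> = frag_of s - chain_cone y k (chain_boundary (Suc k) (frag_of s))"
    by (simp add: chain_boundary_of chain_cone_sum chain_cone_cmul del: sum.atMost_Suc)
  finally show ?thesis .
qed

text \<open>In dimension 0 coning is not a contraction: the apex remains as a point. This is the
  source of the multiple of \<open>const_point y\<close> left over in
  \<open>cone_contract_reduces\<close>.\<close>

lemma chain_boundary_cone_0: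
  assumes "s \<in> extensional (standard_simplex 0)"
  shows "chain_boundary (Suc 0) (frag_of (coned_simplex y 0 s))
       = frag_of s - frag_of (restrict (\<lambda>_. y) (standard_simplex 0))"
  using assms by (simp add: chain_boundary_of singular_face_0_coned_simplex singular_face_1_coned_simplex_0)

section \<open>Prisms and the contraction of cubical chains\<close>

definition cube_prism :: "(nat \<Rightarrow> real) \<Rightarrow> nat \<Rightarrow> ((nat \<Rightarrow> real) \<Rightarrow> nat \<Rightarrow> real) \<Rightarrow> (nat \<Rightarrow> real) \<Rightarrow> nat \<Rightarrow> real" where
  "cube_prism y n T =
     restrict (\<lambda>x i. (1 - x 0) * y i + x 0 * T (\<lambda>l. x (Suc l)) i) (standard_cube (Suc n))"

lemma cube_shift_in: "x \<in> standard_cube (Suc n) \<Longrightarrow> (\<lambda>l. x (Suc l)) \<in> standard_cube n"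
  by (auto simp: standard_cube_def)

lemma singular_cube_prism:
  assumes T: "singular_cube n (subtopology (powertop_real UNIV) Y) T"
    and Y: "convex_in_box Y"
    and y: "y \<in> Y"
  shows "singular_cube (Suc n) (subtopology (powertop_real UNIV) Y) (cube_prism y n T)"
proof -
  let ?D = "standard_cube (Suc n)"
  have TY: "T x \<in> Y" if "x \<in> standard_cube n" for x
    using T that by (auto simp: singular_cube_def continuous_map_in_subtopology Pi_iff image_subset_iff)
  have "continuous_map (subtopology (powertop_real UNIV) (standard_cube n)) euclideanreal (\<lambda>x. T x i)" for i
    using T by (auto simp: singular_cube_def continuous_map_in_subtopology continuous_map_componentwise)
  then have "continuous_map (subtopology (powertop_real UNIV) ?D) euclideanreal (restrict (\<lambda>x. T (\<lambda>l. x (Suc l)) i) ?D)" for i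
    by (rule continuous_map_restrict_compose) (auto intro: cube_shift_in continuous_map_coordinate)
  then have "continuous_map (subtopology (powertop_real UNIV) ?D) euclideanreal (\<lambda>x. T (\<lambda>l. x (Suc l)) i)" for i
    by (rule continuous_map_eq) auto
  then have "continuous_map (subtopology (powertop_real UNIV) ?D) euclideanreal
       (\<lambda>x. (1 - x 0) * y i + x 0 * T (\<lambda>l. x (Suc l)) i)" for i
    by (intro continuous_map_add continuous_map_real_mult continuous_map_diff continuous_map_coordinate) auto
  then have "continuous_map (subtopology (powertop_real UNIV) ?D) (powertop_real UNIV)
       (\<lambda>x i. (1 - x 0) * y i + x 0 * T (\<lambda>l. x (Suc l)) i)"
    by (auto simp: continuous_map_componentwise)
  moreover have "(\<lambda>i. (1 - x 0) * y i + x 0 * T (\<lambda>l. x (Suc l)) i) \<in> Y" if "x \<in> ?D" for x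
    using that by (intro convex_in_boxD1[OF Y] y TY cube_shift_in) (auto simp: standard_cube_def)
  ultimately have "continuous_map (subtopology (powertop_real UNIV) ?D) (subtopology (powertop_real UNIV) Y)
       (\<lambda>x i. (1 - x 0) * y i + x 0 * T (\<lambda>l. x (Suc l)) i)"
    by (auto simp: continuous_map_in_subtopology)
  then have "continuous_map (subtopology (powertop_real UNIV) ?D) (subtopology (powertop_real UNIV) Y) (cube_prism y n T)"
    by (rule continuous_map_eq) (auto simp: cube_prism_def)
  then show ?thesis
    by (simp add: singular_cube_def cube_prism_def)
qed

lemma cube_ins_0: "cube_ins 0 v x 0 = v"
  by (simp add: cube_ins_def)

lemma cube_face_prism_0:
  "cube_face (Suc n) 0 (Suc 0) (cube_prism y n T) = restrict (\<lambda>_. y) (standard_cube n)"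
  by (auto simp: cube_face_Suc cube_prism_def restrict_def cube_ins_in_cube cube_ins_0)

lemma cube_face_prism_1:
  assumes "T \<in> extensional (standard_cube n)"
  shows "cube_face (Suc n) 1 (Suc 0) (cube_prism y n T) = T"
proof -
  have "(\<lambda>l. cube_ins 0 1 x (Suc l)) = x" for x
    by (auto simp: cube_ins_def)
  then show ?thesis
    using assms
    by (auto simp: cube_face_Suc cube_prism_def restrict_def cube_ins_in_cube cube_ins_0 extensional_def)
qed

lemma cube_face_prism_Suc:
  assumes "j \<le> n" "v \<in> {0,1}"
  shows "cube_face (Suc (Suc n)) v (Suc (Suc j)) (cube_prism y (Suc n) T)
       = cube_prism y n (cube_face (Suc n) v (Suc j) T)"
proof -
  have "cube_ins (Suc j) v x \<in> standard_cube (Suc (Suc n))" if "x \<in> standard_cube (Suc n)" for x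
    using assms that by (auto intro!: cube_ins_in_cube)
  moreover have "(\<lambda>l. cube_ins (Suc j) v x (Suc l)) = cube_ins j v (\<lambda>l. x (Suc l))" for x
  proof
    fix l show "cube_ins (Suc j) v x (Suc l) = cube_ins j v (\<lambda>l. x (Suc l)) l"
      by (cases l) (auto simp: cube_ins_def)
  qed
  moreover have "cube_ins (Suc j) v x 0 = x 0" for x
    by (simp add: cube_ins_def)
  ultimately show ?thesis
    by (auto simp: cube_face_Suc cube_prism_def restrict_def cube_shift_in)
qed

context cubical_weights
begin

text \<open>The unmodified prism would contribute \<open>a\<close> times the constant cube plus
  \<open>b\<close> times \<open>T\<close> in direction 0; thickening that direction yields
  \<open>T\<close> minus the constant cube.\<close>

definition cube_contract :: "(nat \<Rightarrow> real) \<Rightarrow> nat \<Rightarrow> (nat \<Rightarrow> real) chain \<Rightarrow> (nat \<Rightarrow> real) chain" where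
  "cube_contract y n = frag_extend (\<lambda>T. thick (Suc n) 0 (frag_of (cube_prism y n T)))"

lemma cube_contract_of: "cube_contract y n (frag_of T) = thick (Suc n) 0 (frag_of (cube_prism y n T))"
  and cube_contract_0 [simp]: "cube_contract y n 0 = 0"
  and cube_contract_add: "cube_contract y n (c + d) = cube_contract y n c + cube_contract y n d"
  and cube_contract_diff: "cube_contract y n (c - d) = cube_contract y n c - cube_contract y n d"
  and cube_contract_cmul: "cube_contract y n (frag_cmul m c) = frag_cmul m (cube_contract y n c)"
  by (simp_all add: cube_contract_def frag_extend_add frag_extend_diff frag_extend_cmul)

lemma cube_contract_sum: "cube_contract y k (sum f I) = (\<Sum>i\<in>I. cube_contract y k (f i))"
  by (induction I rule: infinite_finite_induct) (auto simp: cube_contract_add)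

lemma cube_chain_contract:
  assumes "cube_chain n (subtopology (powertop_real UNIV) Y) c"
    and "convex_in_box Y"
    and "y \<in> Y"
  shows "cube_chain (Suc n) (subtopology (powertop_real UNIV) Y) (cube_contract y n c)"
  unfolding cube_contract_def
  using assms
  by (intro cube_chain_extend cube_chain_thick) (auto simp: cube_chain_def intro!: singular_cube_prism)

text \<open>The prism from \<open>y\<close> over a cube constantly equal to \<open>y\<close> is
  itself constant, and \<theta> vanishes in a point.\<close>

lemma cube_contract_const:
  "cube_contract y n (frag_of (restrict (\<lambda>_. y) (standard_cube n))) = 0"
proof -
  have "cube_prism y n (restrict (\<lambda>_. y) (standard_cube n)) = restrict (\<lambda>_. y) (standard_cube (Suc n))"
    by (auto simp: cube_prism_def restrict_def cube_shift_in algebra_simps)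
  then show ?thesis
    unfolding cube_contract_of by (simp only:) (rule thick_degenerate; auto simp: upd_in_cube)
qed

text \<open>Direction 0 of the thickened prism gives the identity minus the collapse to
  \<open>y\<close>. The other directions are those of \<open>c\<close> moved up by one, which
  reverses their signs. Being a chain of singular cubes makes each \<open>T\<close> extensional, so
  that the end of the prism at 1 is \<open>T\<close> itself.\<close>

lemma cube_boundary_contract:
  assumes "cube_chain n X c"
  shows "cube_boundary a b (Suc n) (cube_contract y n c)
       = c - cube_map n (\<lambda>_. y) c - cube_contract y (n - 1) (cube_boundary a b n c)"
proof (rule additive_eq_on_frag[of "\<lambda>c. cube_boundary a b (Suc n) (cube_contract y n c)"
     "\<lambda>c. c - cube_map n (\<lambda>_. y) c - cube_contract y (n - 1) (cube_boundary a b n c)"])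
  fix T assume "T \<in> Poly_Mapping.keys c"
  then have T: "T \<in> extensional (standard_cube n)"
    using assms by (auto simp: cube_chain_def singular_cube_def)
  let ?P = "thick (Suc n) 0 (frag_of (cube_prism y n T))"
  define W where "W j = frag_cmul a (cface n 0 j ?P) + frag_cmul b (cface n 1 j ?P)" for j
  have W0: "W 0 = frag_of T - cube_map n (\<lambda>_. y) (frag_of T)"
    using T by (simp add: W_def wface_thick_same cube_face_prism_0 cube_face_prism_1 o_def)
  have WS: "W (Suc j) = cube_contract y m (frag_cmul a (cface m 0 j (frag_of T)) + frag_cmul b (cface m 1 j (frag_of T)))"
    if "n = Suc m" "j \<le> m" for j m
    using that
    by (simp add: W_def cface_thick_less cube_face_prism_Suc cube_contract_add cube_contract_cmul cube_contract_of)
  have "cube_boundary a b (Suc n) (cube_contract y n (frag_of T)) = (\<Sum>j\<le>n. frag_cmul ((-1) ^ j) (W j))"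
    by (simp only: cube_boundary_Suc W_def cube_contract_of)
  also have "\<dots> = W 0 - cube_contract y (n - 1) (cube_boundary a b n (frag_of T))"
  proof (cases n)
    case (Suc m)
    then have "(\<Sum>j\<le>n. frag_cmul ((-1) ^ j) (W j)) = W 0 + (\<Sum>j\<le>m. frag_cmul ((-1) ^ Suc j) (W (Suc j)))"
      by (simp add: sum.atMost_Suc_shift del: sum.atMost_Suc)
    also have "\<dots> = W 0 - (\<Sum>j\<le>m. frag_cmul ((-1) ^ j) (W (Suc j)))"
      by (simp add: sum_negf[symmetric] flip: add_uminus_conv_diff)
    also have "(\<Sum>j\<le>m. frag_cmul ((-1) ^ j) (W (Suc j))) = cube_contract y (n - 1) (cube_boundary a b n (frag_of T))"
      unfolding Suc cube_boundary_Suc cube_contract_sum diff_Suc_1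
      by (rule sum.cong) (simp_all add: WS[OF Suc] cube_contract_cmul del: cface_of)
    finally show ?thesis .
  qed simp
  finally show "cube_boundary a b (Suc n) (cube_contract y n (frag_of T))
       = frag_of T - cube_map n (\<lambda>_. y) (frag_of T) - cube_contract y (n - 1) (cube_boundary a b n (frag_of T))"
    by (simp add: W0)
qed (simp_all add: cube_boundary_diff cube_contract_diff cube_map_diff)

end

section \<open>The mapping cone\<close>

text \<open>Cubes and simplices become generators of a single free abelian group, distinguished by a
  tag, so that the acyclic-models induction can treat all generators alike.\<close>

type_synonym 'a cone_chain = "(nat \<times> ((nat \<Rightarrow> real) \<Rightarrow> 'a)) \<Rightarrow>\<^sub>0 int"

definition cone_dom :: "nat \<Rightarrow> nat \<Rightarrow> (nat \<Rightarrow> real) set" where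
  "cone_dom n i = (case i of 0 \<Rightarrow> standard_cube n | Suc k \<Rightarrow> standard_simplex k)"

lemma cone_dom_simps [simp]: "cone_dom n 0 = standard_cube n" "cone_dom n (Suc k) = standard_simplex k"
  by (simp_all add: cone_dom_def)

text \<open>The source of f enters the cone shifted by one degree: tag \<open>Suc k\<close> in
  degree \<open>n\<close> stands for a \<open>k\<close>-simplex times the constant cube of dimension
  \<open>n - Suc k\<close>, hence \<open>Suc k \<le> n\<close>.\<close>

definition cone_cell :: "nat \<Rightarrow> 'a topology \<Rightarrow> nat \<times> ((nat \<Rightarrow> real) \<Rightarrow> 'a) \<Rightarrow> bool" where
  "cone_cell n X = (\<lambda>(i, T). i \<le> n \<and> continuous_map (subtopology (powertop_real UNIV) (cone_dom n i)) X T
      \<and> T \<in> extensional (cone_dom n i))"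

lemma cone_cell_0: "cone_cell n X (0, T) \<longleftrightarrow> singular_cube n X T"
  and cone_cell_Suc: "cone_cell n X (Suc k, T) \<longleftrightarrow> k < n \<and> singular_simplex k X T"
  by (auto simp: cone_cell_def singular_cube_def singular_simplex_def)

definition cone_chain :: "nat \<Rightarrow> 'a topology \<Rightarrow> 'a cone_chain \<Rightarrow> bool" where
  "cone_chain n X c \<longleftrightarrow> Poly_Mapping.keys c \<subseteq> Collect (cone_cell n X)"

lemma cone_chain_0 [simp]: "cone_chain n X 0"
  and cone_chain_of [simp]: "cone_chain n X (frag_of T) \<longleftrightarrow> cone_cell n X T"
  and cone_chain_cmul: "cone_chain n X c \<Longrightarrow> cone_chain n X (frag_cmul k c)"
  and cone_chain_minus: "cone_chain n X c \<Longrightarrow> cone_chain n X (- c)"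
  by (auto simp: cone_chain_def)

lemma cone_chain_add: "cone_chain n X c \<Longrightarrow> cone_chain n X d \<Longrightarrow> cone_chain n X (c + d)"
  unfolding cone_chain_def using keys_add[of c d] by blast

lemma cone_chain_diff: "cone_chain n X c \<Longrightarrow> cone_chain n X d \<Longrightarrow> cone_chain n X (c - d)"
  unfolding cone_chain_def using keys_diff[of c d] by blast

lemma cone_chain_sum: "(\<And>i. i \<in> I \<Longrightarrow> cone_chain n X (f i)) \<Longrightarrow> cone_chain n X (sum f I)"
  by (induction I rule: infinite_finite_induct) (auto simp: cone_chain_add)

lemma cone_chain_extend:
  "(\<And>T. T \<in> Poly_Mapping.keys c \<Longrightarrow> cone_chain n X (f T)) \<Longrightarrow> cone_chain n X (frag_extend f c)"
  by (simp add: frag_extend_def cone_chain_cmul cone_chain_sum)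

definition tag :: "nat \<Rightarrow> 'a chain \<Rightarrow> 'a cone_chain" where
  "tag i = frag_extend (\<lambda>T. frag_of (i, T))"

lemma tag_of: "tag i (frag_of T) = frag_of (i, T)"
  and tag_0 [simp]: "tag i 0 = 0"
  and tag_add: "tag i (c + d) = tag i c + tag i d"
  and tag_diff: "tag i (c - d) = tag i c - tag i d"
  and tag_minus: "tag i (- c) = - tag i c"
  and tag_cmul: "tag i (frag_cmul m c) = frag_cmul m (tag i c)"
  by (simp_all add: tag_def frag_extend_add frag_extend_diff frag_extend_cmul frag_extend_minus)

definition untag :: "nat \<Rightarrow> 'a cone_chain \<Rightarrow> 'a chain" where
  "untag i = frag_extend (\<lambda>(j, T). if j = i then frag_of T else 0)"

lemma untag_0 [simp]: "untag i 0 = 0"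
  and untag_add: "untag i (c + d) = untag i c + untag i d"
  and untag_diff: "untag i (c - d) = untag i c - untag i d"
  and untag_minus: "untag i (- c) = - untag i c"
  and untag_cmul: "untag i (frag_cmul m c) = frag_cmul m (untag i c)"
  by (simp_all add: untag_def frag_extend_add frag_extend_diff frag_extend_cmul frag_extend_minus)

lemma untag_tag: "untag i (tag j c) = (if i = j then c else 0)"
  by (rule additive_eq_on_frag[of "\<lambda>c. untag i (tag j c)" "\<lambda>c. if i = j then c else 0"])
     (auto simp: tag_diff tag_of untag_def frag_extend_diff)

lemma untag_sum: "untag i (sum f I) = (\<Sum>j\<in>I. untag i (f j))"
  by (induction I rule: infinite_finite_induct) (auto simp: untag_add)

lemma cone_chain_tag_0: "cube_chain n X c \<Longrightarrow> cone_chain n X (tag 0 c)"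
  unfolding tag_def by (rule cone_chain_extend) (auto simp: cube_chain_def cone_cell_0)

lemma cone_chain_tag_Suc: "singular_chain k X c \<Longrightarrow> k < n \<Longrightarrow> cone_chain n X (tag (Suc k) c)"
  unfolding tag_def by (rule cone_chain_extend) (auto simp: singular_chain_def cone_cell_Suc)

lemma cube_chain_untag_0: "cone_chain n X c \<Longrightarrow> cube_chain n X (untag 0 c)"
  unfolding untag_def by (rule cube_chain_extend) (auto simp: cone_chain_def cone_cell_0)

lemma singular_chain_untag_Suc: "cone_chain n X c \<Longrightarrow> singular_chain k X (untag (Suc k) c)"
  unfolding untag_def by (rule singular_chain_extend) (auto simp: cone_chain_def cone_cell_Suc singular_chain_of)

lemma tag_untag:
  assumes "cone_chain n X c"
  shows "c = (\<Sum>i\<le>n. tag i (untag i c))"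
proof (rule additive_eq_on_frag[of "\<lambda>c. c" "\<lambda>c. \<Sum>i\<le>n. tag i (untag i c)"])
  fix p assume "p \<in> Poly_Mapping.keys c"
  then obtain i T where p: "p = (i, T)" "i \<le> n"
    using assms by (auto simp: cone_chain_def cone_cell_def)
  have "(\<Sum>j\<le>n. tag j (untag j (frag_of p))) = (\<Sum>j\<le>n. if j = i then frag_of p else 0)"
    using p by (intro sum.cong) (auto simp: untag_tag simp flip: tag_of)
  also have "\<dots> = frag_of p"
    using p by simp
  finally show "frag_of p = (\<Sum>i\<le>n. tag i (untag i (frag_of p)))" ..
qed (simp_all add: untag_diff tag_diff sum_subtractf)

definition cone_map :: "nat \<Rightarrow> ('a \<Rightarrow> 'b) \<Rightarrow> 'a cone_chain \<Rightarrow> 'b cone_chain" where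
  "cone_map n g = frag_extend (\<lambda>(i, T). frag_of (i, restrict (g \<circ> T) (cone_dom n i)))"

lemma cone_map_of: "cone_map n g (frag_of (i, T)) = frag_of (i, restrict (g \<circ> T) (cone_dom n i))"
  and cone_map_0 [simp]: "cone_map n g 0 = 0"
  and cone_map_add: "cone_map n g (c + d) = cone_map n g c + cone_map n g d"
  and cone_map_diff: "cone_map n g (c - d) = cone_map n g c - cone_map n g d"
  and cone_map_minus: "cone_map n g (- c) = - cone_map n g c"
  and cone_map_cmul: "cone_map n g (frag_cmul m c) = frag_cmul m (cone_map n g c)"
  by (simp_all add: cone_map_def frag_extend_add frag_extend_diff frag_extend_cmul frag_extend_minus)

lemma cone_map_tag_0: "cone_map n g (tag 0 c) = tag 0 (cube_map n g c)"
  by (rule additive_eq_on_frag[of "\<lambda>c. cone_map n g (tag 0 c)" "\<lambda>c. tag 0 (cube_map n g c)"])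
     (simp_all add: cone_map_diff tag_diff cube_map_diff tag_of cone_map_of)

lemma cone_map_tag_Suc: "cone_map n g (tag (Suc k) c) = tag (Suc k) (chain_map k g c)"
  by (rule additive_eq_on_frag[of "\<lambda>c. cone_map n g (tag (Suc k) c)" "\<lambda>c. tag (Suc k) (chain_map k g c)"])
     (simp_all add: cone_map_diff tag_diff chain_map_diff tag_of cone_map_of simplex_map_def)

lemma cone_map_compose: "cone_map n g (cone_map n h c) = cone_map n (g \<circ> h) c"
proof (rule additive_eq_on_frag[of "\<lambda>c. cone_map n g (cone_map n h c)" "\<lambda>c. cone_map n (g \<circ> h) c"])
  fix p show "cone_map n g (cone_map n h (frag_of p)) = cone_map n (g \<circ> h) (frag_of p)"
    by (cases p) (auto simp: cone_map_of frag_of_eq restrict_def)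
qed (simp_all add: cone_map_diff)

lemma cone_chain_map:
  assumes "continuous_map Y X g" "cone_chain n Y c"
  shows "cone_chain n X (cone_map n g c)"
  unfolding cone_map_def
proof (rule cone_chain_extend)
  fix p assume "p \<in> Poly_Mapping.keys c"
  then have "cone_cell n Y p"
    using assms by (auto simp: cone_chain_def)
  then show "cone_chain n X (case p of (i, T) \<Rightarrow> frag_of (i, restrict (g \<circ> T) (cone_dom n i)))"
    using assms(1) by (cases p) (auto simp: cone_cell_def intro: continuous_map_compose)
qed

lemma cone_map_cong:
  assumes "cone_chain n Y c" "\<And>y. y \<in> topspace Y \<Longrightarrow> g y = h y"
  shows "cone_map n g c = cone_map n h c"
  unfolding cone_map_def
proof (rule frag_extend_eq)
  fix p assume "p \<in> Poly_Mapping.keys c"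
  then have "cone_cell n Y p"
    using assms by (auto simp: cone_chain_def)
  then show "(case p of (i, T) \<Rightarrow> frag_of (i, restrict (g \<circ> T) (cone_dom n i)))
      = (case p of (i, T) \<Rightarrow> frag_of (i, restrict (h \<circ> T) (cone_dom n i)))"
    using assms(2) by (cases p) (auto simp: cone_cell_def continuous_map_def Pi_iff frag_of_eq restrict_def)
qed

context cubical_weights
begin

text \<open>The mapping cone of the comparison map. In degree \<open>n\<close>, tag \<open>0\<close> marks cubes of dimension \<open>n\<close> and
  tag \<open>Suc k\<close> marks simplices of dimension \<open>k < n\<close>.\<close>

definition cone_bd :: "nat \<Rightarrow> 'a cone_chain \<Rightarrow> 'a cone_chain" where
  "cone_bd n = frag_extend (\<lambda>(i, T). case i of
       0 \<Rightarrow> - tag 0 (cube_boundary a b n (frag_of T))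
     | Suc k \<Rightarrow> tag 0 (simp_to_cube (n - 1) k (frag_of T)) + tag k (chain_boundary k (frag_of T))
         + (if odd (n - Suc k) then frag_cmul ((-1) ^ k * (a + b)) (tag (Suc k) (frag_of T)) else 0))"

lemma cone_bd_0 [simp]: "cone_bd n 0 = 0"
  and cone_bd_add: "cone_bd n (c + d) = cone_bd n c + cone_bd n d"
  and cone_bd_diff: "cone_bd n (c - d) = cone_bd n c - cone_bd n d"
  and cone_bd_minus: "cone_bd n (- c) = - cone_bd n c"
  and cone_bd_cmul: "cone_bd n (frag_cmul m c) = frag_cmul m (cone_bd n c)"
  by (simp_all add: cone_bd_def frag_extend_add frag_extend_diff frag_extend_cmul frag_extend_minus)

lemma cone_bd_tag_0: "cone_bd n (tag 0 c) = - tag 0 (cube_boundary a b n c)"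
  by (rule additive_eq_on_frag[of "\<lambda>c. cone_bd n (tag 0 c)" "\<lambda>c. - tag 0 (cube_boundary a b n c)"])
     (simp_all add: tag_diff cube_boundary_diff tag_of cone_bd_def frag_extend_diff)

text \<open>For k > 0 the boundary of a \<open>k\<close>-simplex has tag Suc (k - 1), which is
  \<open>k\<close>. For k = 0 the tag would mean cubes, but the boundary is then 0, so one formula
  covers both cases.\<close>

lemma cone_bd_tag_Suc: "cone_bd n (tag (Suc k) c) =
    tag 0 (simp_to_cube (n - 1) k c) + tag k (chain_boundary k c)
      + (if odd (n - Suc k) then frag_cmul ((-1) ^ k * (a + b)) (tag (Suc k) c) else 0)"
  by (rule additive_eq_on_frag[of "\<lambda>c. cone_bd n (tag (Suc k) c)" "\<lambda>c. tag 0 (simp_to_cube (n - 1) k c) + tag k (chain_boundary k c)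
      + (if odd (n - Suc k) then frag_cmul ((-1) ^ k * (a + b)) (tag (Suc k) c) else 0)"])
     (simp_all add: tag_diff chain_boundary_diff simp_to_cube_diff frag_cmul_diff tag_of cone_bd_def frag_extend_diff)

lemma cone_additive_eq:
  fixes f g :: "'a cone_chain \<Rightarrow> 'b::ab_group_add"
  assumes "\<And>x y. f (x - y) = f x - f y" "\<And>x y. g (x - y) = g x - g y"
    and "cone_chain n X c"
    and cube: "\<And>T. singular_cube n X T \<Longrightarrow> f (tag 0 (frag_of T)) = g (tag 0 (frag_of T))"
    and simplex: "\<And>k s. k < n \<Longrightarrow> singular_simplex k X s \<Longrightarrow> f (tag (Suc k) (frag_of s)) = g (tag (Suc k) (frag_of s))"
  shows "f c = g c"
proof (rule additive_eq_on_frag[of f g, OF assms(1,2)])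
  fix p assume "p \<in> Poly_Mapping.keys c"
  then have p: "cone_cell n X p"
    using assms(3) by (auto simp: cone_chain_def)
  obtain i T where iT: "p = (i, T)" by fastforce
  show "f (frag_of p) = g (frag_of p)"
  proof (cases i)
    case 0
    then show ?thesis using cube[of T] p iT by (auto simp: cone_cell_0 tag_of)
  next
    case (Suc k)
    then show ?thesis using simplex[of k T] p iT by (auto simp: cone_cell_Suc tag_of)
  qed
qed

lemma cone_chain_bd:
  assumes "cone_chain (Suc n) X c"
  shows "cone_chain n X (cone_bd (Suc n) c)"
  unfolding cone_bd_def
proof (rule cone_chain_extend)
  fix p assume "p \<in> Poly_Mapping.keys c"
  then have p: "cone_cell (Suc n) X p"
    using assms by (auto simp: cone_chain_def)
  obtain i T where iT: "p = (i, T)" by fastforce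
  show "cone_chain n X (case p of (i, T) \<Rightarrow> case i of
       0 \<Rightarrow> - tag 0 (cube_boundary a b (Suc n) (frag_of T))
     | Suc k \<Rightarrow> tag 0 (simp_to_cube (Suc n - 1) k (frag_of T)) + tag k (chain_boundary k (frag_of T))
         + (if odd (Suc n - Suc k) then frag_cmul ((-1) ^ k * (a + b)) (tag (Suc k) (frag_of T)) else 0))"
  proof (cases i)
    case 0
    then have "cube_chain n X (cube_boundary a b (Suc n) (frag_of T))"
      using p iT cube_chain_boundary[of "Suc n" X "frag_of T"] by (auto simp: cone_cell_0)
    then show ?thesis
      using 0 iT by (simp add: cone_chain_minus cone_chain_tag_0)
  next
    case (Suc k)
    then have k: "k \<le> n" "singular_chain k X (frag_of T)"
      using p iT by (auto simp: cone_cell_Suc singular_chain_of)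
    have "cone_chain n X (tag k (chain_boundary k (frag_of T)))"
    proof (cases k)
      case (Suc m)
      then show ?thesis
        using k singular_chain_boundary[OF k(2)] by (auto intro: cone_chain_tag_Suc)
    qed (simp add: chain_boundary_def)
    moreover have "k < n" if "odd (n - k)"
      using that by (cases "k < n") auto
    ultimately show ?thesis
      using k Suc iT
      by (auto intro!: cone_chain_add cone_chain_cmul cone_chain_tag_0 cone_chain_tag_Suc cube_chain_simp_to_cube)
  qed
qed

text \<open>The cube part cancels because f is a chain map and cubes carry the negative boundary. In
  the simplex part, the two terms that combine a simplicial boundary with \<sigma> cancel since
  \<open>(-1) ^ k\<close> changes sign with \<open>k\<close>, and \<sigma> never acts twice because
  the parity of the complementary dimension changes.\<close>

lemma cone_bd_bd:
  assumes "cone_chain (Suc n) X c"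
  shows "cone_bd n (cone_bd (Suc n) c) = 0"
proof (rule cone_additive_eq[of "\<lambda>c. cone_bd n (cone_bd (Suc n) c)" "\<lambda>_. 0", OF _ _ assms])
  fix T :: "(nat \<Rightarrow> real) \<Rightarrow> 'a"
  show "cone_bd n (cone_bd (Suc n) (tag 0 (frag_of T))) = 0"
    by (simp add: cone_bd_tag_0 cone_bd_minus cube_boundary_boundary)
next
  fix k and s :: "(nat \<Rightarrow> real) \<Rightarrow> 'a"
  assume k: "k < Suc n" and s: "singular_simplex k X s"
  let ?s = "frag_of s"
  have ss: "singular_chain k X ?s"
    using s by (simp add: singular_chain_of)
  show "cone_bd n (cone_bd (Suc n) (tag (Suc k) ?s)) = 0"
  proof (cases n)
    case 0
    then show ?thesis using k by (simp add: cone_bd_tag_Suc cone_bd_add cone_bd_tag_0 chain_boundary_def)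
  next
    case (Suc m)
    have bF: "cube_boundary a b n (simp_to_cube n k ?s) = simp_to_cube m (k - 1) (chain_boundary k ?s)
      + (if odd (n - k) then frag_cmul ((-1) ^ k * (a + b)) (simp_to_cube m k ?s) else 0)"
      using cube_boundary_simp_to_cube[of k m ?s] k Suc by simp
    show ?thesis
    proof (cases k)
      case 0
      then show ?thesis
        using Suc bF by (simp add: cone_bd_tag_Suc cone_bd_add cone_bd_tag_0 cone_bd_cmul chain_boundary_def tag_add tag_cmul)
    next
      case (Suc l)
      have bb: "chain_boundary l (chain_boundary k ?s) = 0"
        using chain_boundary_boundary[OF ss] Suc by simp
      have "odd (n - Suc k) \<Longrightarrow> even (n - k)"
        using k by (cases "k = n") auto
      then show ?thesis
        using Suc bF bb \<open>n = Suc m\<close>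
        by (intro poly_mapping_eqI)
           (auto simp: cone_bd_tag_Suc cone_bd_add cone_bd_tag_0 cone_bd_cmul tag_add tag_cmul lookup_add lookup_minus algebra_simps)
    qed
  qed
qed (simp_all add: cone_bd_diff)

lemma cone_bd_map:
  assumes "cone_chain n X c"
  shows "cone_bd n (cone_map n g c) = cone_map (n - 1) g (cone_bd n c)"
proof (rule cone_additive_eq[of "\<lambda>c. cone_bd n (cone_map n g c)" "\<lambda>c. cone_map (n - 1) g (cone_bd n c)", OF _ _ assms])
  fix T :: "(nat \<Rightarrow> real) \<Rightarrow> 'a"
  show "cone_bd n (cone_map n g (tag 0 (frag_of T))) = cone_map (n - 1) g (cone_bd n (tag 0 (frag_of T)))"
    by (simp add: cone_bd_tag_0 cone_map_tag_0 cone_map_minus cube_boundary_cube_map del: cube_map_of)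
next
  fix k and s :: "(nat \<Rightarrow> real) \<Rightarrow> 'a"
  assume k: "k < n" and s: "singular_simplex k X s"
  let ?s = "frag_of s"
  have "tag k (chain_boundary k (chain_map k g ?s)) = cone_map (n - 1) g (tag k (chain_boundary k ?s))"
  proof (cases k)
    case (Suc l)
    then show ?thesis
      using chain_boundary_chain_map[of k X ?s g] s by (simp add: singular_chain_of cone_map_tag_Suc del: chain_map_of)
  qed (simp add: chain_boundary_def)
  then show "cone_bd n (cone_map n g (tag (Suc k) ?s)) = cone_map (n - 1) g (cone_bd n (tag (Suc k) ?s))"
    using k by (simp add: cone_bd_tag_Suc cone_map_tag_Suc cone_map_add cone_map_cmul cone_map_tag_0
       simp_to_cube_chain_map del: chain_map_of)
qed (simp_all add: cone_bd_diff cone_map_diff)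

end

section \<open>Acyclic models\<close>

definition const_cube :: "nat \<Rightarrow> 'a \<Rightarrow> (nat \<Rightarrow> real) \<Rightarrow> 'a" where
  "const_cube n y = restrict (\<lambda>_. y) (standard_cube n)"

definition const_point :: "'a \<Rightarrow> (nat \<Rightarrow> real) \<Rightarrow> 'a" where
  "const_point y = restrict (\<lambda>_. y) (standard_simplex 0)"

definition cone_contract :: "(nat \<Rightarrow> real) \<Rightarrow> (nat \<Rightarrow> real) cone_chain \<Rightarrow> (nat \<Rightarrow> real) cone_chain" where
  "cone_contract y = frag_extend (\<lambda>(i, T). case i of 0 \<Rightarrow> 0 | Suc k \<Rightarrow> frag_of (Suc (Suc k), coned_simplex y k T))"

lemma cone_contract_0 [simp]: "cone_contract y 0 = 0"
  and cone_contract_add: "cone_contract y (c + d) = cone_contract y c + cone_contract y d"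
  and cone_contract_diff: "cone_contract y (c - d) = cone_contract y c - cone_contract y d"
  and cone_contract_minus: "cone_contract y (- c) = - cone_contract y c"
  and cone_contract_cmul: "cone_contract y (frag_cmul m c) = frag_cmul m (cone_contract y c)"
  by (simp_all add: cone_contract_def frag_extend_add frag_extend_diff frag_extend_cmul frag_extend_minus)

lemma cone_contract_tag_0: "cone_contract y (tag 0 c) = 0"
  by (rule additive_eq_on_frag[of "\<lambda>c. cone_contract y (tag 0 c)" "\<lambda>_. 0"])
     (simp_all add: tag_diff tag_of cone_contract_def frag_extend_diff)

lemma cone_contract_tag_Suc: "cone_contract y (tag (Suc k) c) = tag (Suc (Suc k)) (chain_cone y k c)"
  by (rule additive_eq_on_frag[of "\<lambda>c. cone_contract y (tag (Suc k) c)" "\<lambda>c. tag (Suc (Suc k)) (chain_cone y k c)"])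
     (simp_all add: tag_diff chain_cone_diff tag_of cone_contract_def frag_extend_diff)

lemma cone_chain_contract:
  assumes "cone_chain n (subtopology (powertop_real UNIV) Y) c"
    and Y: "convex_in_box Y"
    and y: "y \<in> Y"
  shows "cone_chain (Suc n) (subtopology (powertop_real UNIV) Y) (cone_contract y c)"
  unfolding cone_contract_def
proof (rule cone_chain_extend)
  fix p assume "p \<in> Poly_Mapping.keys c"
  then have p: "cone_cell n (subtopology (powertop_real UNIV) Y) p"
    using assms(1) by (auto simp: cone_chain_def)
  obtain i T where iT: "p = (i, T)" by fastforce
  show "cone_chain (Suc n) (subtopology (powertop_real UNIV) Y)
     (case p of (i, T) \<Rightarrow> case i of 0 \<Rightarrow> 0 | Suc k \<Rightarrow> frag_of (Suc (Suc k), coned_simplex y k T))"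
  proof (cases i)
    case (Suc k)
    then have "k < n" "singular_simplex k (subtopology (powertop_real UNIV) Y) T"
      using p iT by (auto simp: cone_cell_Suc)
    then show ?thesis
      using Suc iT singular_coned_simplex[OF _ Y y] by (simp add: cone_cell_Suc)
  qed (simp add: iT)
qed

lemma cube_map_const: "\<exists>m. cube_map n (\<lambda>_. y) c = frag_cmul m (frag_of (const_cube n y))"
proof (induction c rule: frag_induction[OF order_refl])
  case 1
  show ?case by (rule exI[of _ 0]) simp
next
  case (2 T)
  show ?case by (rule exI[of _ 1]) (simp add: frag_of_eq const_cube_def o_def restrict_def)
next
  case (3 c d)
  then obtain m m' where "cube_map n (\<lambda>_. y) c = frag_cmul m (frag_of (const_cube n y))"
     "cube_map n (\<lambda>_. y) d = frag_cmul m' (frag_of (const_cube n y))" by blast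
  then show ?case
    by (intro exI[of _ "m - m'"]) (simp add: cube_map_diff frag_cmul_diff_distrib)
qed

context cubical_weights
begin

text \<open>Coning is a homotopy on the simplicial part except at 0-simplices, and it ignores cubes.
  What it leaves over is a cubical chain and a multiple of the apex; in degree 0 the cone complex
  has no simplices, hence \<open>m = 0\<close> there.\<close>

lemma cone_contract_reduces:
  assumes "cone_chain n (subtopology (powertop_real UNIV) Y) c"
    and Y: "convex_in_box Y"
    and y: "y \<in> Y"
  shows "\<exists>z m. cube_chain n (subtopology (powertop_real UNIV) Y) z \<and> (n = 0 \<longrightarrow> m = 0) \<and>
     c - cone_bd (Suc n) (cone_contract y c) - cone_contract y (cone_bd n c)
       = tag 0 z + tag 1 (frag_cmul m (frag_of (const_point y)))"
proof -
  let ?Y = "subtopology (powertop_real UNIV) Y"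
  show ?thesis
    using assms(1) unfolding cone_chain_def
  proof (induction c rule: frag_induction)
    case zero
    show ?case by (rule exI[of _ 0], rule exI[of _ 0]) simp
  next
    case (one p)
    obtain i T where iT: "p = (i, T)" by fastforce
    show ?case
    proof (cases i)
      case 0
      then have "cube_chain n ?Y (frag_of T)"
        using one iT by (simp add: cone_cell_0)
      then show ?thesis
        using 0 iT
        by (intro exI[of _ "frag_of T"] exI[of _ 0])
           (simp add: cone_contract_tag_0 cone_bd_tag_0 cone_contract_minus flip: tag_of)
    next
      case (Suc k)
      then have k: "k < n" and T: "singular_simplex k ?Y T"
        using one iT by (auto simp: cone_cell_Suc)
      have ext: "T \<in> extensional (standard_simplex k)"
        using T by (simp add: singular_simplex_def)
      have "singular_simplex (Suc k) ?Y (coned_simplex y k T)"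
        using singular_coned_simplex[OF T Y y] by simp
      then have z: "cube_chain n ?Y (simp_to_cube n (Suc k) (frag_of (coned_simplex y k T)))"
        using k by (intro cube_chain_simp_to_cube) (auto simp: singular_chain_of)
      \<comment> \<open>The two terms with \<sigma> cancel: coning raises degree and simplex
        dimension together, which preserves the parity test but reverses the sign
        \<open>(-1) ^ k\<close>.\<close>
      have eq: "frag_of p - cone_bd (Suc n) (cone_contract y (frag_of p)) - cone_contract y (cone_bd n (frag_of p))
         = tag 0 (- simp_to_cube n (Suc k) (frag_of (coned_simplex y k T)))
           + (tag (Suc k) (frag_of T - chain_boundary (Suc k) (frag_of (coned_simplex y k T)))
              - cone_contract y (tag k (chain_boundary k (frag_of T))))"
        using k
        by (intro poly_mapping_eqI)
           (simp add: iT Suc cone_contract_tag_Suc cone_contract_tag_0 cone_bd_tag_Suc cone_contract_add cone_contract_cmul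
             tag_minus tag_diff lookup_add lookup_minus flip: tag_of)
      show ?thesis
      proof (cases k)
        case 0
        then show ?thesis
          using z eq k ext
          by (intro exI[of _ "- simp_to_cube n (Suc k) (frag_of (coned_simplex y k T))"] exI[of _ 1])
             (simp add: chain_boundary_cone_0[folded const_point_def] chain_boundary_def[of 0] cube_chain_minus)
      next
        case (Suc l)
        then show ?thesis
          using z eq k ext
          by (intro exI[of _ "- simp_to_cube n (Suc k) (frag_of (coned_simplex y k T))"] exI[of _ 0])
             (simp add: chain_boundary_cone_Suc cube_chain_minus cone_contract_tag_Suc)
      qed
    qed
  next
    case (diff c d)
    then obtain z m z' m' where
      "cube_chain n ?Y z" "n = 0 \<longrightarrow> m = 0" "c - cone_bd (Suc n) (cone_contract y c) - cone_contract y (cone_bd n c)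
       = tag 0 z + tag 1 (frag_cmul m (frag_of (const_point y)))"
      "cube_chain n ?Y z'" "n = 0 \<longrightarrow> m' = 0" "d - cone_bd (Suc n) (cone_contract y d) - cone_contract y (cone_bd n d)
       = tag 0 z' + tag 1 (frag_cmul m' (frag_of (const_point y)))"
      by blast
    moreover have "c - d - cone_bd (Suc n) (cone_contract y (c - d)) - cone_contract y (cone_bd n (c - d))
      = (c - cone_bd (Suc n) (cone_contract y c) - cone_contract y (cone_bd n c))
       - (d - cone_bd (Suc n) (cone_contract y d) - cone_contract y (cone_bd n d))"
      by (simp add: cone_bd_diff cone_contract_diff)
    ultimately show ?case
      by (intro exI[of _ "z - z'"] exI[of _ "m - m'"])
         (simp add: cube_chain_diff tag_diff tag_cmul frag_cmul_diff_distrib)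
  qed
qed

lemma simp_to_cube_const:
  "simp_to_cube n 0 (frag_of (const_point y)) = frag_of (const_cube n y)"
  by (simp add: simp_to_cube_of simplex_cube_def) (auto simp: frag_of_eq const_cube_def const_point_def restrict_def cube_to_simplex_in)

text \<open>Coning and the thickened prism push a cycle to the constant cube and the point at
  \<open>y\<close>. There f sends the point to the constant cube in every degree, so the cone over
  the point is acyclic; the integers \<open>m\<close> and \<open>q\<close> carry out this last
  argument.\<close>

lemma cone_acyclic_convex:
  assumes c: "cone_chain n (subtopology (powertop_real UNIV) Y) c" and cyc: "cone_bd n c = 0"
    and Y: "convex_in_box Y"
    and y: "y \<in> Y"
  shows "\<exists>d. cone_chain (Suc n) (subtopology (powertop_real UNIV) Y) d \<and> cone_bd (Suc n) d = c"
proof -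
  let ?Y = "subtopology (powertop_real UNIV) Y"
  let ?pt = "frag_of (const_point y)"
  define K where "K n = frag_of (const_cube n y)" for n
  have FK: "simp_to_cube n 0 ?pt = K n" for n
    by (simp add: K_def simp_to_cube_const)
  define d1 where "d1 = cone_contract y c"
  have d1: "cone_chain (Suc n) ?Y d1"
    unfolding d1_def by (rule cone_chain_contract[OF c Y y])
  obtain z m where z: "cube_chain n ?Y z" and m0: "n = 0 \<Longrightarrow> m = 0"
    and red: "c - cone_bd (Suc n) d1 = tag 0 z + tag 1 (frag_cmul m ?pt)"
    using cone_contract_reduces[OF c Y y] cyc unfolding d1_def by auto
  have "cone_bd n (tag 0 z + tag 1 (frag_cmul m ?pt)) = 0"
    unfolding red[symmetric] using cyc cone_bd_bd[OF d1] by (simp add: cone_bd_diff)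
  then have "untag 0 (cone_bd n (tag 0 z + tag 1 (frag_cmul m ?pt))) = 0"
    by simp
  then have bz: "cube_boundary a b n z = frag_cmul m (K (n - 1))"
    by (auto simp: cone_bd_add cone_bd_tag_0 cone_bd_tag_Suc untag_add untag_diff untag_minus untag_tag untag_cmul
          simp_to_cube_cmul FK chain_boundary_def split: if_splits)
  obtain q where q: "cube_map n (\<lambda>_. y) z = frag_cmul q (K n)"
    using cube_map_const[of n y z] unfolding K_def by auto
  \<comment> \<open>The boundary of \<open>z\<close> is a multiple of the constant cube, on which
    the contraction vanishes. So \<open>z\<close> and \<open>q\<close> constant cubes differ by a
    boundary.\<close>
  have "cube_contract y (n - 1) (cube_boundary a b n z) = 0"
    by (simp add: bz cube_contract_cmul cube_contract_const[folded const_cube_def] K_def)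
  then have zq: "cube_boundary a b (Suc n) (cube_contract y n z) = z - frag_cmul q (K n)"
    using cube_boundary_contract[OF z, of y] q by simp
  \<comment> \<open>Collapse the equation \<open>bz\<close> to \<open>y\<close>: the left side
    becomes the boundary of \<open>q\<close> constant \<open>n\<close>-cubes, that is \<sigma> q or
    0 according to the parity of \<open>n\<close>. Reading off the coefficient of the constant cube
    gives an identity of integers.\<close>
  have mq: "m = (if odd n then (a + b) * q else 0)"
  proof (cases n)
    case (Suc l)
    have "cube_map l (\<lambda>_. y) (cube_boundary a b n z) = cube_boundary a b n (cube_map n (\<lambda>_. y) z)"
      using Suc by (simp add: cube_boundary_cube_map)
    also have "\<dots> = frag_cmul q (if odd n then frag_cmul (a + b) (K l) else 0)"
      using cube_boundary_simp_to_cube[of 0 l ?pt] Suc unfolding q cube_boundary_cmul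
      by (auto simp: FK chain_boundary_def)
    also have "cube_map l (\<lambda>_. y) (cube_boundary a b n z) = frag_cmul m (K l)"
      unfolding bz cube_map_cmul
      using Suc by (simp add: K_def const_cube_def o_def restrict_def cong: if_cong)
    finally have "frag_cmul m (K l) = frag_cmul (if odd n then (a + b) * q else 0) (K l)"
      by (simp add: mult.commute split: if_splits)
    then have "Poly_Mapping.lookup (frag_cmul m (K l)) (const_cube l y)
       = Poly_Mapping.lookup (frag_cmul (if odd n then (a + b) * q else 0) (K l)) (const_cube l y)"
      by simp
    then show ?thesis
      by (simp only: lookup_frag_cmul) (simp add: K_def)
  qed (use m0 in simp)
  \<comment> \<open>The points with coefficient \<open>q\<close> contribute \<open>q\<close>
    constant cubes through f and, for odd \<open>n\<close>, the \<open>m\<close> points; the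
    contraction of \<open>z\<close> corrects \<open>q\<close> constant cubes to
    \<open>z\<close>.\<close>
  define d2 where "d2 = tag 1 (frag_cmul q ?pt) - tag 0 (cube_contract y n z)"
  have "singular_simplex 0 ?Y (const_point y)"
    using y by (simp add: const_point_def singular_simplex_def continuous_map_in_subtopology)
  then have "singular_chain 0 ?Y (frag_cmul q ?pt)"
    by (simp add: singular_chain_cmul singular_chain_of)
  then have d2: "cone_chain (Suc n) ?Y d2"
    unfolding d2_def
    using cone_chain_tag_Suc[of 0 ?Y "frag_cmul q ?pt" "Suc n"] cube_chain_contract[OF z Y y]
    by (intro cone_chain_diff cone_chain_tag_0) auto
  have "cone_bd (Suc n) d2 = tag 0 z + tag 1 (frag_cmul m ?pt)"
    using zq mq
    by (simp add: d2_def frag_cmul_distrib2 cone_bd_diff cone_bd_cmul cone_bd_tag_0 cone_bd_tag_Suc simp_to_cube_cmul FK chain_boundary_def tag_diff tag_cmul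
          mult.commute)
  then have "cone_bd (Suc n) (d1 + d2) = c"
    using red by (simp add: cone_bd_add algebra_simps)
  then show ?thesis
    using d1 d2 cone_chain_add by blast
qed

section \<open>Natural contraction built on universal cells\<close>

abbreviation model :: "nat \<Rightarrow> nat \<Rightarrow> (nat \<Rightarrow> real) topology" where
  "model n i \<equiv> subtopology (powertop_real UNIV) (cone_dom n i)"

lemma cone_acyclic_model:
  assumes "cone_chain m (model n i) c" "cone_bd m c = 0"
  shows "\<exists>d. cone_chain (Suc m) (model n i) d \<and> cone_bd (Suc m) d = c"
proof (cases i)
  case 0
  have "(\<lambda>_. 0) \<in> standard_cube n"
    by (simp add: standard_cube_def)
  then show ?thesis
    using assms cone_acyclic_convex[of m "standard_cube n" c] 0 convex_in_box_cube by simp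
next
  case (Suc k)
  obtain y where "y \<in> standard_simplex k"
    using nonempty_standard_simplex by blast
  then show ?thesis
    using assms cone_acyclic_convex[of m "standard_simplex k" c] Suc convex_in_box_simplex by simp
qed

text \<open>Acyclic models: \<open>h i\<close> is the value of a natural operator on the universal cell with tag \<open>i\<close>.\<close>

definition nat_op :: "nat \<Rightarrow> (nat \<Rightarrow> (nat \<Rightarrow> real) cone_chain) \<Rightarrow> 'a cone_chain \<Rightarrow> 'a cone_chain" where
  "nat_op n h = frag_extend (\<lambda>(i, T). cone_map (Suc n) T (h i))"

lemma nat_op_0 [simp]: "nat_op n h 0 = 0"
  and nat_op_diff: "nat_op n h (c - d) = nat_op n h c - nat_op n h d"
  and nat_op_of: "nat_op n h (frag_of (i, T)) = cone_map (Suc n) T (h i)"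
  by (simp_all add: nat_op_def frag_extend_diff)

definition model_op :: "nat \<Rightarrow> (nat \<Rightarrow> (nat \<Rightarrow> real) cone_chain) \<Rightarrow> bool" where
  "model_op n h \<longleftrightarrow> (\<forall>i\<le>n. cone_chain (Suc n) (model n i) (h i))"

definition universal_cell :: "nat \<Rightarrow> nat \<Rightarrow> (nat \<Rightarrow> real) cone_chain" where
  "universal_cell n i = frag_of (i, restrict (\<lambda>x. x) (cone_dom n i))"

lemma cone_chain_universal_cell: "i \<le> n \<Longrightarrow> cone_chain n (model n i) (universal_cell n i)"
  by (auto simp: universal_cell_def cone_cell_def continuous_map_in_subtopology)

lemma cone_map_universal_cell:
  assumes "cone_cell n X (i, T)"
  shows "cone_map n T (universal_cell n i) = frag_of (i, T)"
  using assms
  by (auto simp: universal_cell_def cone_map_of frag_of_eq cone_cell_def restrict_def extensional_def)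

lemma cone_cell_continuous: "cone_cell n X (i, T) \<Longrightarrow> i \<le> n \<and> continuous_map (model n i) X T"
  by (simp add: cone_cell_def)

lemma cone_chain_nat_op:
  assumes "model_op n h" "cone_chain n X c"
  shows "cone_chain (Suc n) X (nat_op n h c)"
  unfolding nat_op_def
proof (rule cone_chain_extend)
  fix p assume "p \<in> Poly_Mapping.keys c"
  then have "cone_cell n X p"
    using assms(2) by (auto simp: cone_chain_def)
  then show "cone_chain (Suc n) X (case p of (i, T) \<Rightarrow> cone_map (Suc n) T (h i))"
    using assms(1) cone_cell_continuous[of n X "fst p" "snd p"]
    by (cases p) (auto simp: model_op_def intro: cone_chain_map)
qed

lemma nat_op_map:
  assumes h: "model_op n h" and c: "cone_chain n Y c"
  shows "nat_op n h (cone_map n g c) = cone_map (Suc n) g (nat_op n h c)"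
proof (rule additive_eq_on_frag[of "\<lambda>c. nat_op n h (cone_map n g c)" "\<lambda>c. cone_map (Suc n) g (nat_op n h c)"])
  fix p assume "p \<in> Poly_Mapping.keys c"
  then have p: "cone_cell n Y p"
    using c by (auto simp: cone_chain_def)
  obtain i T where iT: "p = (i, T)" by fastforce
  \<comment> \<open>Restricting a cell to its domain changes nothing here, since the cells of
    \<open>h i\<close> take their values in the model.\<close>
  have "cone_map (Suc n) (restrict (g \<circ> T) (cone_dom n i)) (h i) = cone_map (Suc n) (g \<circ> T) (h i)"
    using h p iT by (intro cone_map_cong[where Y="model n i"]) (auto simp: model_op_def cone_cell_def)
  then show "nat_op n h (cone_map n g (frag_of p)) = cone_map (Suc n) g (nat_op n h (frag_of p))"
    by (simp add: iT cone_map_of nat_op_of cone_map_compose)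
qed (simp_all add: nat_op_diff cone_map_diff)

text \<open>Every cell is the image of a universal cell under its own underlying map, and both sides
  are natural, so the identity on universal cells propagates to every space.\<close>

lemma nat_op_homotopy:
  assumes h: "model_op (Suc n) h" and h': "model_op n h'"
    and hh': "\<And>i. i \<le> Suc n \<Longrightarrow> cone_bd (Suc (Suc n)) (h i)
       = universal_cell (Suc n) i - nat_op n h' (cone_bd (Suc n) (universal_cell (Suc n) i))"
    and c: "cone_chain (Suc n) X c"
  shows "cone_bd (Suc (Suc n)) (nat_op (Suc n) h c) = c - nat_op n h' (cone_bd (Suc n) c)"
proof (rule additive_eq_on_frag[of "\<lambda>c. cone_bd (Suc (Suc n)) (nat_op (Suc n) h c)"
      "\<lambda>c. c - nat_op n h' (cone_bd (Suc n) c)"])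
  fix p assume "p \<in> Poly_Mapping.keys c"
  then have p: "cone_cell (Suc n) X p"
    using c by (auto simp: cone_chain_def)
  obtain i T where iT: "p = (i, T)" by fastforce
  let ?u = "universal_cell (Suc n) i"
  have i: "i \<le> Suc n"
    using p iT by (simp add: cone_cell_def)
  have u: "cone_chain (Suc n) (model (Suc n) i) ?u"
    by (rule cone_chain_universal_cell[OF i])
  have "cone_bd (Suc (Suc n)) (nat_op (Suc n) h (frag_of p)) = cone_map (Suc n) T (cone_bd (Suc (Suc n)) (h i))"
    using h i cone_bd_map[of "Suc (Suc n)" "model (Suc n) i" "h i" T] by (simp add: iT nat_op_of model_op_def)
  also have "\<dots> = cone_map (Suc n) T ?u - cone_map (Suc n) T (nat_op n h' (cone_bd (Suc n) ?u))"
    by (simp add: hh'[OF i] cone_map_diff)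
  also have "cone_map (Suc n) T (nat_op n h' (cone_bd (Suc n) ?u)) = nat_op n h' (cone_map n T (cone_bd (Suc n) ?u))"
    by (rule nat_op_map[OF h' cone_chain_bd[OF u], symmetric])
  also have "cone_map n T (cone_bd (Suc n) ?u) = cone_bd (Suc n) (cone_map (Suc n) T ?u)"
    using cone_bd_map[OF u, of T] by simp
  finally show "cone_bd (Suc (Suc n)) (nat_op (Suc n) h (frag_of p)) = frag_of p - nat_op n h' (cone_bd (Suc n) (frag_of p))"
    using cone_map_universal_cell[of "Suc n" X i T] p iT by simp
qed (simp_all add: cone_bd_diff nat_op_diff)

lemma nat_op_homotopy_0:
  assumes h: "model_op 0 h" and "cone_bd (Suc 0) (h 0) = universal_cell 0 0" and c: "cone_chain 0 X c"
  shows "cone_bd (Suc 0) (nat_op 0 h c) = c"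
proof (rule additive_eq_on_frag[of "\<lambda>c. cone_bd (Suc 0) (nat_op 0 h c)" "\<lambda>c. c"])
  fix p assume "p \<in> Poly_Mapping.keys c"
  then have p: "cone_cell 0 X p"
    using c by (auto simp: cone_chain_def)
  then obtain T where iT: "p = (0, T)" by (cases p) (auto simp: cone_cell_def)
  then show "cone_bd (Suc 0) (nat_op 0 h (frag_of p)) = frag_of p"
    using assms p cone_bd_map[of "Suc 0" "model 0 0" "h 0" T] cone_map_universal_cell[of 0 X 0 T]
    by (simp add: nat_op_of model_op_def)
qed (simp_all add: cone_bd_diff nat_op_diff)

text \<open>The conditions concern only values on universal cells in
  \<open>nat \<Rightarrow> real\<close>, so the resulting \<open>h\<close> acts, through
  \<open>nat_op\<close>, on spaces of any type.\<close>

lemma natural_contraction: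
  obtains h where "\<And>n. model_op n (h n)" "cone_bd (Suc 0) (h 0 0) = universal_cell 0 0"
    "\<And>n i. i \<le> Suc n \<Longrightarrow> cone_bd (Suc (Suc n)) (h (Suc n) i)
       = universal_cell (Suc n) i - nat_op n (h n) (cone_bd (Suc n) (universal_cell (Suc n) i))"
proof -
  \<comment> \<open>The invariant for dependent choice: the operator fills every cycle of its degree
    in spaces of the type of the models. \<open>Q\<close> is the link between consecutive
    degrees.\<close>
  define P where "P n h \<longleftrightarrow> model_op n h \<and> (n = 0 \<longrightarrow> cone_bd (Suc 0) (h 0) = universal_cell 0 0) \<and>
      (\<forall>(Y::(nat \<Rightarrow> real) topology) c. cone_chain n Y c \<longrightarrow> cone_bd n c = 0 \<longrightarrow> cone_bd (Suc n) (nat_op n h c) = c)" for n h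
  define Q where "Q n h h' \<longleftrightarrow> (\<forall>i\<le>Suc n. cone_bd (Suc (Suc n)) (h' i)
       = universal_cell (Suc n) i - nat_op n h (cone_bd (Suc n) (universal_cell (Suc n) i)))"
    for n :: nat and h h' :: "nat \<Rightarrow> (nat \<Rightarrow> real) cone_chain"
  have "\<exists>h. P 0 h"
  proof -
    have u: "cone_chain 0 (model 0 0) (universal_cell 0 0)"
      by (rule cone_chain_universal_cell) simp
    moreover have "cone_bd 0 (universal_cell 0 0) = 0"
      by (simp add: universal_cell_def cone_bd_tag_0 flip: tag_of)
    ultimately obtain d where d: "cone_chain (Suc 0) (model 0 0) d" "cone_bd (Suc 0) d = universal_cell 0 0"
      using cone_acyclic_model by blast
    then have "P 0 (\<lambda>_. d)"
      using nat_op_homotopy_0[of "\<lambda>_. d"] by (auto simp: P_def model_op_def)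
    then show ?thesis by blast
  qed
  moreover have "\<exists>h'. P (Suc n) h' \<and> Q n h h'" if "P n h" for n h
  proof -
    have h: "model_op n h"
      using that by (simp add: P_def)
    have "\<exists>d. cone_chain (Suc (Suc n)) (model (Suc n) i) d \<and> cone_bd (Suc (Suc n)) d
       = universal_cell (Suc n) i - nat_op n h (cone_bd (Suc n) (universal_cell (Suc n) i))" if "i \<le> Suc n" for i
    proof (rule cone_acyclic_model)
      note u = cone_chain_universal_cell[OF that]
      show "cone_chain (Suc n) (model (Suc n) i)
          (universal_cell (Suc n) i - nat_op n h (cone_bd (Suc n) (universal_cell (Suc n) i)))"
        by (intro cone_chain_diff u cone_chain_nat_op[OF h] cone_chain_bd)
      \<comment> \<open>The boundary of the universal cell is a cycle, so by the invariant the
        operator \<open>h\<close> fills it, and the two boundaries cancel.\<close>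
      show "cone_bd (Suc n) (universal_cell (Suc n) i - nat_op n h (cone_bd (Suc n) (universal_cell (Suc n) i))) = 0"
        using \<open>P n h\<close> cone_chain_bd[OF u] cone_bd_bd[OF u] by (simp add: cone_bd_diff P_def)
    qed
    then obtain h' where h': "\<And>i. i \<le> Suc n \<Longrightarrow> cone_chain (Suc (Suc n)) (model (Suc n) i) (h' i) \<and>
        cone_bd (Suc (Suc n)) (h' i) = universal_cell (Suc n) i - nat_op n h (cone_bd (Suc n) (universal_cell (Suc n) i))"
      by metis
    then have "model_op (Suc n) h'" "Q n h h'"
      by (auto simp: model_op_def Q_def)
    moreover have "cone_bd (Suc (Suc n)) (nat_op (Suc n) h' c) = c"
      if "cone_chain (Suc n) Y c" "cone_bd (Suc n) c = 0" for Y :: "(nat \<Rightarrow> real) topology" and c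
      using nat_op_homotopy[OF \<open>model_op (Suc n) h'\<close> h _ that(1)] h' that(2) by simp
    ultimately show ?thesis
      by (auto simp: P_def)
  qed
  ultimately obtain h where "\<And>n. P n (h n) \<and> Q n (h n) (h (Suc n))"
    using dependent_nat_choice[of P Q] by blast
  then show ?thesis
    by (intro that[of h]) (auto simp: P_def Q_def)
qed

text \<open>The difference between \<open>c\<close> and the boundary of its contraction is the
  contraction of the boundary of \<open>c\<close>. By naturality this stays in \<open>B\<close> when
  the boundary of \<open>c\<close> does.\<close>

lemma cone_relative_acyclic:
  assumes c: "cone_chain n X c" and bc: "cone_chain (n - 1) (subtopology X B) (cone_bd n c)"
  obtains d where "cone_chain (Suc n) X d" "cone_chain n (subtopology X B) (c - cone_bd (Suc n) d)"
proof -
  obtain h where h: "\<And>n. model_op n (h n)" and h0: "cone_bd (Suc 0) (h 0 0) = universal_cell 0 0"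
    and hS: "\<And>n i. i \<le> Suc n \<Longrightarrow> cone_bd (Suc (Suc n)) (h (Suc n) i)
       = universal_cell (Suc n) i - nat_op n (h n) (cone_bd (Suc n) (universal_cell (Suc n) i))"
    using natural_contraction by metis
  have "cone_chain n (subtopology X B) (c - cone_bd (Suc n) (nat_op n (h n) c))"
  proof (cases n)
    case 0
    then show ?thesis
      using nat_op_homotopy_0[OF h h0, of X c] c by simp
  next
    case (Suc m)
    then show ?thesis
      using nat_op_homotopy[OF h h hS, of m X c] c bc cone_chain_nat_op[OF h, of m "subtopology X B" "cone_bd n c"] by simp
  qed
  with cone_chain_nat_op[OF h c] show ?thesis
    using that by blast
qed

end

section \<open>The total complex\<close>

text \<open>Applied to a subspace, this says that the relative chain group has no torsion, so
  \<sigma> can be cancelled modulo chains of \<open>B\<close>.\<close>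

lemma singular_chain_frag_cmulD: "singular_chain p X (frag_cmul s c) \<Longrightarrow> s \<noteq> 0 \<Longrightarrow> singular_chain p X c"
  by (auto simp: singular_chain_def subset_iff)

lemma cone_chainI_untag:
  assumes "cone_chain n X c" "cube_chain n Y (untag 0 c)"
    and "\<And>k. k < n \<Longrightarrow> singular_chain k Y (untag (Suc k) c)"
  shows "cone_chain n Y c"
proof -
  have "cone_chain n Y (tag i (untag i c))" if "i \<le> n" for i
    using assms that by (cases i) (auto intro: cone_chain_tag_0 cone_chain_tag_Suc)
  then have "cone_chain n Y (\<Sum>i\<le>n. tag i (untag i c))"
    by (intro cone_chain_sum) auto
  then show ?thesis
    using tag_untag[OF assms(1)] by simp
qed

context cubical_weights
begin

text \<open>The total complex \<open>S(X) \<otimes> K(point)\<close>: in degree \<open>n\<close> a chain is a family \<open>e\<close> of singular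
  \<open>k\<close>-chains, \<open>k \<le> n\<close>, where \<open>e k\<close> is the coefficient of the constant \<open>(n - k)\<close>-cube.\<close>

definition tot_bd :: "nat \<Rightarrow> (nat \<Rightarrow> 'a chain) \<Rightarrow> nat \<Rightarrow> 'a chain" where
  "tot_bd n e k = chain_boundary (Suc k) (e (Suc k))
     + (if odd (n - k) then frag_cmul ((-1) ^ k * (a + b)) (e k) else 0)"

definition tot_to_cube :: "nat \<Rightarrow> (nat \<Rightarrow> 'a chain) \<Rightarrow> 'a chain" where
  "tot_to_cube n e = (\<Sum>k\<le>n. simp_to_cube n k (e k))"

lemma untag_0_cone_bd:
  assumes "cone_chain n X c"
  shows "untag 0 (cone_bd n c) = (\<Sum>k<n. simp_to_cube (n - 1) k (untag (Suc k) c)) - cube_boundary a b n (untag 0 c)"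
proof (rule cone_additive_eq[OF _ _ assms, where f="\<lambda>c. untag 0 (cone_bd n c)" and
      g="\<lambda>c. (\<Sum>k<n. simp_to_cube (n - 1) k (untag (Suc k) c)) - cube_boundary a b n (untag 0 c)"])
  fix k and s :: "(nat \<Rightarrow> real) \<Rightarrow> 'a"
  assume k: "k < n"
  have "untag 0 (tag k (chain_boundary k (frag_of s))) = 0"
    by (cases k) (simp_all add: untag_tag chain_boundary_def)
  moreover have "(\<Sum>l<n. simp_to_cube (n - 1) l (untag (Suc l) (tag (Suc k) (frag_of s))))
      = (\<Sum>l<n. if l = k then simp_to_cube (n - 1) k (frag_of s) else 0)"
    by (intro sum.cong) (auto simp: untag_tag)
  ultimately show "untag 0 (cone_bd n (tag (Suc k) (frag_of s))) =
    (\<Sum>l<n. simp_to_cube (n - 1) l (untag (Suc l) (tag (Suc k) (frag_of s))))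
      - cube_boundary a b n (untag 0 (tag (Suc k) (frag_of s)))"
    using k by (simp add: cone_bd_tag_Suc untag_add untag_tag untag_cmul)
qed (simp_all add: untag_diff cone_bd_diff simp_to_cube_diff sum_subtractf cube_boundary_diff cone_bd_tag_0 untag_tag untag_minus)

text \<open>The simplicial part of cone degree \<open>Suc n\<close> is the total complex in degree
  \<open>n\<close>; the cone differential restricts to its differential without a change of
  sign.\<close>

lemma untag_Suc_cone_bd:
  assumes "cone_chain (Suc n) X c"
  shows "untag (Suc k) (cone_bd (Suc n) c) = tot_bd n (\<lambda>k. untag (Suc k) c) k"
proof (rule cone_additive_eq[OF _ _ assms, where f="\<lambda>c. untag (Suc k) (cone_bd (Suc n) c)" and
      g="\<lambda>c. tot_bd n (\<lambda>k. untag (Suc k) c) k"])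
  fix l and s :: "(nat \<Rightarrow> real) \<Rightarrow> 'a"
  show "untag (Suc k) (cone_bd (Suc n) (tag (Suc l) (frag_of s))) = tot_bd n (\<lambda>k. untag (Suc k) (tag (Suc l) (frag_of s))) k"
    by (auto simp: tot_bd_def cone_bd_tag_Suc untag_add untag_tag untag_cmul)
qed (simp_all add: untag_diff cone_bd_diff tot_bd_def chain_boundary_diff frag_cmul_diff cone_bd_tag_0 untag_tag untag_minus)

text \<open>Relative acyclicity of the cone, read in components. Taking \<open>e = 0\<close> and a
  relative cycle \<open>z\<close> will show that f is onto in homology; taking for \<open>z\<close>
  a chain that bounds the image of \<open>e\<close> will show that it is injective.\<close>

lemma comparison_relative:
  assumes e: "\<And>k. k < n \<Longrightarrow> singular_chain k X (e k)" and z: "cube_chain n X z"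
    and be: "\<And>k. Suc k < n \<Longrightarrow> singular_chain k (subtopology X B) (tot_bd (n - 1) e k)"
    and bz: "cube_chain (n - 1) (subtopology X B) ((\<Sum>k<n. simp_to_cube (n - 1) k (e k)) - cube_boundary a b n z)"
  obtains e' z' where "\<And>k. k \<le> n \<Longrightarrow> singular_chain k X (e' k)" "cube_chain (Suc n) X z'"
    "\<And>k. k < n \<Longrightarrow> singular_chain k (subtopology X B) (e k - tot_bd n e' k)"
    "cube_chain n (subtopology X B) (z - tot_to_cube n e' + cube_boundary a b (Suc n) z')"
proof -
  define c where "c = tag 0 z + (\<Sum>k<n. tag (Suc k) (e k))"
  have c: "cone_chain n X c"
    unfolding c_def using e z by (intro cone_chain_add cone_chain_sum cone_chain_tag_0 cone_chain_tag_Suc) auto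
  have u0: "untag 0 c = z"
    by (simp add: c_def untag_add untag_sum untag_tag)
  have uS: "untag (Suc k) c = e k" if "k < n" for k
  proof -
    have "untag (Suc k) c = (\<Sum>l<n. if l = k then e k else 0)"
      unfolding c_def by (simp add: untag_add untag_sum untag_tag)
    then show ?thesis using that by simp
  qed
  have "cone_chain (n - 1) (subtopology X B) (cone_bd n c)"
  proof (cases n)
    case 0
    then have "cone_bd n c = 0"
      by (simp add: c_def cone_bd_tag_0)
    then show ?thesis by simp
  next
    case (Suc m)
    show ?thesis
    proof (rule cone_chainI_untag)
      show "cone_chain (n - 1) X (cone_bd n c)"
        using cone_chain_bd c Suc by simp
      have "(\<Sum>k<n. simp_to_cube (n - 1) k (untag (Suc k) c)) = (\<Sum>k<n. simp_to_cube (n - 1) k (e k))"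
        by (rule sum.cong) (auto simp: uS)
      then show "cube_chain (n - 1) (subtopology X B) (untag 0 (cone_bd n c))"
        using bz by (simp add: untag_0_cone_bd[OF c] u0)
      fix k assume k: "k < n - 1"
      then have "tot_bd m (\<lambda>k. untag (Suc k) c) k = tot_bd m e k"
        using uS[of k] uS[of "Suc k"] Suc by (simp add: tot_bd_def)
      then show "singular_chain k (subtopology X B) (untag (Suc k) (cone_bd n c))"
        using be[of k] untag_Suc_cone_bd[of m X c k] c Suc k by simp
    qed
  qed
  then obtain d where d: "cone_chain (Suc n) X d" "cone_chain n (subtopology X B) (c - cone_bd (Suc n) d)"
    using cone_relative_acyclic[OF c] by blast
  show thesis
  proof (rule that[of "\<lambda>k. untag (Suc k) d" "untag 0 d"])
    show "singular_chain k X (untag (Suc k) d)" for k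
      by (rule singular_chain_untag_Suc[OF d(1)])
    show "cube_chain (Suc n) X (untag 0 d)"
      by (rule cube_chain_untag_0[OF d(1)])
    show "singular_chain k (subtopology X B) (e k - tot_bd n (\<lambda>k. untag (Suc k) d) k)" if "k < n" for k
      using singular_chain_untag_Suc[OF d(2), of k] that
      by (simp add: untag_diff uS untag_Suc_cone_bd[OF d(1)])
    show "cube_chain n (subtopology X B) (z - tot_to_cube n (\<lambda>k. untag (Suc k) d) + cube_boundary a b (Suc n) (untag 0 d))"
      using cube_chain_untag_0[OF d(2)]
      by (simp add: untag_diff u0 untag_0_cone_bd[OF d(1)] tot_to_cube_def lessThan_Suc_atMost
          diff_diff_eq2 diff_add_eq)
  qed
qed

lemma cube_boundary_sum: "cube_boundary a b n (sum f I) = (\<Sum>i\<in>I. cube_boundary a b n (f i))"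
  by (induction I rule: infinite_finite_induct) (auto simp: cube_boundary_add)

text \<open>The index ranges match because the top-dimensional component is paired with a 0-cube and
  yields no term with \<sigma>, and the 0-dimensional one has no simplicial boundary.\<close>

lemma cube_boundary_tot_to_cube:
  "cube_boundary a b (Suc n) (tot_to_cube (Suc n) e) = tot_to_cube n (tot_bd (Suc n) e)"
proof -
  let ?g = "\<lambda>k. if odd (Suc n - k) then frag_cmul ((-1) ^ k * (a + b)) (simp_to_cube n k (e k)) else 0"
  have "cube_boundary a b (Suc n) (tot_to_cube (Suc n) e)
     = (\<Sum>k\<le>Suc n. simp_to_cube n (k - 1) (chain_boundary k (e k)) + ?g k)"
    unfolding tot_to_cube_def cube_boundary_sum
    by (rule sum.cong) (auto simp: cube_boundary_simp_to_cube)
  also have "\<dots> = (\<Sum>k\<le>Suc n. simp_to_cube n (k - 1) (chain_boundary k (e k))) + (\<Sum>k\<le>Suc n. ?g k)"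
    by (rule sum.distrib)
  also have "(\<Sum>k\<le>Suc n. simp_to_cube n (k - 1) (chain_boundary k (e k)))
      = (\<Sum>k\<le>n. simp_to_cube n k (chain_boundary (Suc k) (e (Suc k))))"
    by (subst sum.atMost_Suc_shift) (simp add: chain_boundary_def[of 0])
  also have "(\<Sum>k\<le>Suc n. ?g k) = (\<Sum>k\<le>n. ?g k)"
    by simp
  also have "(\<Sum>k\<le>n. simp_to_cube n k (chain_boundary (Suc k) (e (Suc k)))) + (\<Sum>k\<le>n. ?g k) = tot_to_cube n (tot_bd (Suc n) e)"
    unfolding tot_to_cube_def sum.distrib[symmetric]
    by (rule sum.cong) (auto simp: tot_bd_def simp_to_cube_add simp_to_cube_cmul)
  finally show ?thesis .
qed

lemma tot_to_cube_diff: "tot_to_cube n (\<lambda>k. e k - e' k) = tot_to_cube n e - tot_to_cube n e'"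
  by (simp add: tot_to_cube_def simp_to_cube_diff sum_subtractf)

lemma tot_to_cube_add: "tot_to_cube n (\<lambda>k. e k + e' k) = tot_to_cube n e + tot_to_cube n e'"
  by (simp add: tot_to_cube_def simp_to_cube_add sum.distrib)

lemma cube_chain_tot_to_cube:
  "(\<And>k. k \<le> n \<Longrightarrow> singular_chain k X (e k)) \<Longrightarrow> cube_chain n X (tot_to_cube n e)"
  unfolding tot_to_cube_def by (intro cube_chain_sum cube_chain_simp_to_cube) auto

definition tot_relcycle :: "nat \<Rightarrow> 'a topology \<Rightarrow> 'a set \<Rightarrow> (nat \<Rightarrow> 'a chain) \<Rightarrow> bool" where
  "tot_relcycle n X B e \<longleftrightarrow> (\<forall>k>n. e k = 0) \<and> (\<forall>k\<le>n. singular_chain k X (e k)) \<and>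
     (\<forall>k<n. singular_chain k (subtopology X B) (tot_bd n e k))"

definition tot_relboundary :: "nat \<Rightarrow> 'a topology \<Rightarrow> 'a set \<Rightarrow> (nat \<Rightarrow> 'a chain) \<Rightarrow> bool" where
  "tot_relboundary n X B e \<longleftrightarrow> (\<exists>e'. (\<forall>k\<le>Suc n. singular_chain k X (e' k)) \<and>
     (\<forall>k\<le>n. singular_chain k (subtopology X B) (e k - tot_bd (Suc n) e' k)))"

lemma tot_to_cube_relcycle:
  assumes "tot_relcycle n X B e"
  shows "cube_relcycle a b n X B (tot_to_cube n e)"
proof -
  have "cube_chain (n - 1) (subtopology X B) (cube_boundary a b n (tot_to_cube n e))"
  proof (cases n)
    case (Suc m)
    then show ?thesis
      using assms unfolding Suc cube_boundary_tot_to_cube diff_Suc_1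
      by (intro cube_chain_tot_to_cube) (auto simp: tot_relcycle_def)
  qed simp
  then show ?thesis
    using assms by (auto simp: cube_relcycle_def tot_relcycle_def intro: cube_chain_tot_to_cube)
qed

lemma tot_to_cube_onto:
  assumes "cube_relcycle a b n X B z"
  obtains e where "tot_relcycle n X B e" "cube_relboundary a b n X B (z - tot_to_cube n e)"
proof -
  have z: "cube_chain n X z" and bz: "cube_chain (n - 1) (subtopology X B) (- cube_boundary a b n z)"
    using assms by (auto simp: cube_relcycle_def intro: cube_chain_minus)
  obtain e' z' where e': "\<And>k. k \<le> n \<Longrightarrow> singular_chain k X (e' k)" and z': "cube_chain (Suc n) X z'"
    and b: "\<And>k. k < n \<Longrightarrow> singular_chain k (subtopology X B) (0 - tot_bd n e' k)"
    and zz: "cube_chain n (subtopology X B) (z - tot_to_cube n e' + cube_boundary a b (Suc n) z')"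
    by (rule comparison_relative[of n X "\<lambda>_. 0" z B]) (use z bz in \<open>auto simp: tot_bd_def\<close>)
  define e where "e k = (if k \<le> n then e' k else 0)" for k
  have "tot_bd n e k = tot_bd n e' k" if "k < n" for k
    using that by (simp add: tot_bd_def e_def)
  moreover have "singular_chain k (subtopology X B) (tot_bd n e' k)" if "k < n" for k
    using b[OF that] by (simp add: singular_chain_minus)
  ultimately have "tot_relcycle n X B e"
    using e' by (auto simp: tot_relcycle_def e_def)
  moreover have "tot_to_cube n e = tot_to_cube n e'"
    by (simp add: tot_to_cube_def e_def)
  \<comment> \<open>Cubes carry the negative boundary in the cone, so the bounding chain is
    \<open>- z'\<close>.\<close>
  moreover have "cube_relboundary a b n X B (z - tot_to_cube n e')"
    unfolding cube_relboundary_def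
    using z' zz cube_boundary_cmul[of a b "Suc n" "-1" z']
    by (intro exI[of _ "- z'"]) (auto simp: cube_chain_minus)
  ultimately show ?thesis
    using that by simp
qed

lemma tot_to_cube_relboundary_iff:
  assumes e: "tot_relcycle n X B e"
  shows "cube_relboundary a b n X B (tot_to_cube n e) \<longleftrightarrow> tot_relboundary n X B e"
proof
  assume "cube_relboundary a b n X B (tot_to_cube n e)"
  then obtain d where d: "cube_chain (Suc n) X d"
    "cube_chain n (subtopology X B) (tot_to_cube n e - cube_boundary a b (Suc n) d)"
    by (auto simp: cube_relboundary_def)
  obtain e' where "\<And>k. k \<le> Suc n \<Longrightarrow> singular_chain k X (e' k)"
    "\<And>k. k < Suc n \<Longrightarrow> singular_chain k (subtopology X B) (e k - tot_bd (Suc n) e' k)"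
    by (rule comparison_relative[of "Suc n" X e d B])
       (use d e in \<open>auto simp: tot_relcycle_def tot_to_cube_def lessThan_Suc_atMost less_Suc_eq_le\<close>)
  then show "tot_relboundary n X B e"
    by (auto simp: tot_relboundary_def less_Suc_eq_le)
next
  assume "tot_relboundary n X B e"
  then obtain e' where e': "\<And>k. k \<le> Suc n \<Longrightarrow> singular_chain k X (e' k)"
    "\<And>k. k \<le> n \<Longrightarrow> singular_chain k (subtopology X B) (e k - tot_bd (Suc n) e' k)"
    by (auto simp: tot_relboundary_def)
  have "cube_chain n (subtopology X B) (tot_to_cube n e - cube_boundary a b (Suc n) (tot_to_cube (Suc n) e'))"
    unfolding cube_boundary_tot_to_cube tot_to_cube_diff[symmetric]
    using e'(2) by (rule cube_chain_tot_to_cube)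
  then show "cube_relboundary a b n X B (tot_to_cube n e)"
    unfolding cube_relboundary_def using cube_chain_tot_to_cube[OF e'(1)] by blast
qed

end

section \<open>Homology groups\<close>

text \<open>The common source will be the group of relative cycles of the total complex, which maps
  onto both homologies. Comparing kernels there avoids forming the homology of the total complex or
  choosing inverses.\<close>

lemma iso_of_common_source:
  assumes "group G" "group H1" "group H2" "h1 \<in> hom G H1" "h2 \<in> hom G H2"
    and "h1 ` carrier G = carrier H1" "h2 ` carrier G = carrier H2"
    and "kernel G H1 h1 = kernel G H2 h2"
  shows "H1 \<cong> H2"
proof -
  interpret h1: group_hom G H1 h1
    using assms by (simp add: group_hom_def group_hom_axioms_def)
  interpret h2: group_hom G H2 h2
    using assms by (simp add: group_hom_def group_hom_axioms_def)
  have 1: "G Mod kernel G H1 h1 \<cong> H1"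
    by (rule h1.FactGroup_iso[OF assms(6)])
  have 2: "G Mod kernel G H1 h1 \<cong> H2"
    using h2.FactGroup_iso[OF assms(7)] assms(8) by simp
  have "group (G Mod kernel G H1 h1)"
    using h1.normal_kernel normal.factorgroup_is_group by blast
  then show ?thesis
    using 1 2 group.iso_sym iso_trans by blast
qed

section \<open>Homology groups as quotients inside free abelian groups\<close>

locale frag_quotient =
  fixes S :: "'k set" and Z U :: "('k \<Rightarrow>\<^sub>0 int) set"
  assumes keys_Z: "\<And>z. z \<in> Z \<Longrightarrow> Poly_Mapping.keys z \<subseteq> S"
    and U_Z: "U \<subseteq> Z" and zero_U: "0 \<in> U"
    and diff_Z: "\<And>x y. x \<in> Z \<Longrightarrow> y \<in> Z \<Longrightarrow> x - y \<in> Z"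
    and diff_U: "\<And>x y. x \<in> U \<Longrightarrow> y \<in> U \<Longrightarrow> x - y \<in> U"
begin

abbreviation cycles :: "('k \<Rightarrow>\<^sub>0 int) monoid" where
  "cycles \<equiv> subgroup_generated (free_Abelian_group S) Z"

abbreviation quot :: "('k \<Rightarrow>\<^sub>0 int) set monoid" where
  "quot \<equiv> cycles Mod U"

definition cls :: "('k \<Rightarrow>\<^sub>0 int) \<Rightarrow> ('k \<Rightarrow>\<^sub>0 int) set" where
  "cls = r_coset cycles U"

lemma add_Z: "x \<in> Z \<Longrightarrow> y \<in> Z \<Longrightarrow> x + y \<in> Z"
  using diff_Z[of x "0 - y"] diff_Z[of 0 y] zero_U U_Z by auto

lemma add_U: "x \<in> U \<Longrightarrow> y \<in> U \<Longrightarrow> x + y \<in> U"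
  using diff_U[of x "0 - y"] diff_U[of 0 y] zero_U by auto

lemma subgroup_Z: "subgroup Z (free_Abelian_group S)"
  using keys_Z U_Z zero_U diff_Z[of 0] by unfold_locales (auto simp: add_Z)

lemma subgroup_U: "subgroup U (free_Abelian_group S)"
  using keys_Z U_Z zero_U diff_U[of 0] by unfold_locales (auto simp: add_U subset_iff)

lemma carrier_cycles: "carrier cycles = Z"
  using subgroup_Z by (simp add: subgroup.carrier_subgroup_generated_subgroup)

lemma comm_group_cycles: "comm_group cycles"
  by (intro group.abelian_subgroup_generated abelian_free_Abelian_group group_free_Abelian_group)

lemma normal_U: "U \<lhd> cycles"
proof -
  have "subgroup U cycles"
    using subgroup_U U_Z by (simp add: group.subgroup_of_subgroup_generated)
  then show ?thesis
    by (simp add: comm_group.normal_iff_subgroup[OF comm_group_cycles])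
qed

lemma group_quot: "group quot"
  by (rule normal.factorgroup_is_group[OF normal_U])

lemma carrier_quot: "carrier quot = cls ` Z"
  by (simp add: carrier_FactGroup carrier_cycles cls_def)

lemma cls_add: "x \<in> Z \<Longrightarrow> y \<in> Z \<Longrightarrow> cls (x + y) = cls x <#>\<^bsub>cycles\<^esub> cls y"
  using normal.rcos_sum[OF normal_U, of x y] by (simp add: cls_def carrier_cycles)

lemma mem_cls: "y \<in> cls x \<longleftrightarrow> y - x \<in> U"
  by (force simp: cls_def r_coset_def)

lemma cls_eq_one_iff: "cls x = U \<longleftrightarrow> x \<in> U"
proof
  assume "cls x = U"
  then show "x \<in> U"
    using mem_cls[of x x] zero_U by simp
next
  assume x: "x \<in> U"
  have "y - x \<in> U \<longleftrightarrow> y \<in> U" for y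
    using add_U[of "y - x" x] diff_U[of y x] x by auto
  then show "cls x = U"
    using mem_cls by blast
qed

lemma cls_eqI: 
  assumes "x - y \<in> U"
  shows "cls x = cls y"
proof -
  have "z - x \<in> U \<longleftrightarrow> z - y \<in> U" for z
    using add_U[of "z - x" "x - y"] diff_U[of "z - y" "x - y"] assms by auto
  then show ?thesis
    using mem_cls by blast
qed

end

lemma frag_quotient_cube:
  "frag_quotient (Collect (singular_cube n X)) (Collect (cube_relcycle a b n X B)) (Collect (cube_relboundary a b n X B))"
proof
  show "Poly_Mapping.keys z \<subseteq> Collect (singular_cube n X)" if "z \<in> Collect (cube_relcycle a b n X B)" for z
    using that by (auto simp: cube_relcycle_def cube_chain_def)
  show "Collect (cube_relboundary a b n X B) \<subseteq> Collect (cube_relcycle a b n X B)"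
  proof clarify
    fix c assume "cube_relboundary a b n X B c"
    then obtain d where d: "cube_chain (Suc n) X d" "cube_chain n (subtopology X B) (c - cube_boundary a b (Suc n) d)"
      by (auto simp: cube_relboundary_def)
    have "cube_chain n X (c - cube_boundary a b (Suc n) d)"
      using d(2) by (auto simp: cube_chain_def singular_cube_def continuous_map_in_subtopology)
    then have "cube_chain n X c"
      using cube_chain_add cube_chain_boundary[OF d(1), of a b] by fastforce
    moreover have "cube_boundary a b n c = cube_boundary a b n (c - cube_boundary a b (Suc n) d)"
      by (simp add: cube_boundary_diff cube_boundary_boundary)
    ultimately show "cube_relcycle a b n X B c"
      using cube_chain_boundary[OF d(2), of a b] by (simp add: cube_relcycle_def)
  qed
  show "x - y \<in> Collect (cube_relcycle a b n X B)"
    if "x \<in> Collect (cube_relcycle a b n X B)" "y \<in> Collect (cube_relcycle a b n X B)" for x y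
    using that by (auto simp: cube_relcycle_def cube_boundary_diff intro: cube_chain_diff)
  show "0 \<in> Collect (cube_relboundary a b n X B)"
    by (auto simp: cube_relboundary_def intro!: exI[of _ 0])
  show "x - y \<in> Collect (cube_relboundary a b n X B)"
    if xy: "x \<in> Collect (cube_relboundary a b n X B)" "y \<in> Collect (cube_relboundary a b n X B)" for x y
  proof -
    obtain d d' where d: "cube_chain (Suc n) X d" "cube_chain n (subtopology X B) (x - cube_boundary a b (Suc n) d)"
      "cube_chain (Suc n) X d'" "cube_chain n (subtopology X B) (y - cube_boundary a b (Suc n) d')"
      using xy by (auto simp: cube_relboundary_def)
    have "x - y - cube_boundary a b (Suc n) (d - d')
        = (x - cube_boundary a b (Suc n) d) - (y - cube_boundary a b (Suc n) d')"
      by (simp add: cube_boundary_diff)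
    then show ?thesis
      using d cube_chain_diff unfolding cube_relboundary_def mem_Collect_eq by metis
  qed
qed

lemma zero_mod_diff: "zero_mod s p X B c \<Longrightarrow> zero_mod s p X B d \<Longrightarrow> zero_mod s p X B (c - d)"
proof -
  assume "zero_mod s p X B c" "zero_mod s p X B d"
  then obtain u v u' v' where "singular_chain p (subtopology X B) u" "singular_chain p X v" "c = u + frag_cmul s v"
    "singular_chain p (subtopology X B) u'" "singular_chain p X v'" "d = u' + frag_cmul s v'"
    by (auto simp: zero_mod_def)
  then show "zero_mod s p X B (c - d)"
    unfolding zero_mod_def
    by (intro exI[of _ "u - u'"] exI[of _ "v - v'"]) (auto simp: singular_chain_diff frag_cmul_diff)
qed

lemma zero_mod_0 [simp]: "zero_mod s p X B 0"
  by (auto simp: zero_mod_def intro!: exI[of _ 0])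

lemma zero_mod_boundary:
  assumes "zero_mod s p X B c"
  shows "zero_mod s (p - 1) X B (chain_boundary p c)"
proof -
  obtain u v where "singular_chain p (subtopology X B) u" "singular_chain p X v" "c = u + frag_cmul s v"
    using assms by (auto simp: zero_mod_def)
  then show ?thesis
    unfolding zero_mod_def using singular_chain_boundary
    by (intro exI[of _ "chain_boundary p u"] exI[of _ "chain_boundary p v"])
       (auto simp: chain_boundary_add chain_boundary_cmul)
qed

lemma zero_mod_imp_chain: "zero_mod s p X B c \<Longrightarrow> singular_chain p X c"
  by (auto simp: zero_mod_def singular_chain_subtopology intro!: singular_chain_add singular_chain_cmul)

lemma frag_quotient_mod:
  "frag_quotient (singular_simplex_set p X) (Collect (relcycle_mod s p X B)) (Collect (relboundary_mod s p X B))"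
proof
  show "Poly_Mapping.keys z \<subseteq> singular_simplex_set p X" if "z \<in> Collect (relcycle_mod s p X B)" for z
    using that by (auto simp: relcycle_mod_def singular_chain_def)
  show "Collect (relboundary_mod s p X B) \<subseteq> Collect (relcycle_mod s p X B)"
  proof clarify
    fix c assume "relboundary_mod s p X B c"
    then obtain d where d: "singular_chain (Suc p) X d" "zero_mod s p X B (c - chain_boundary (Suc p) d)"
      by (auto simp: relboundary_mod_def)
    have "singular_chain p X c"
      using singular_chain_add[OF zero_mod_imp_chain[OF d(2)] singular_chain_boundary_alt[OF d(1)]] by simp
    moreover have "chain_boundary p c = chain_boundary p (c - chain_boundary (Suc p) d)"
      using chain_boundary_boundary_alt[OF d(1)] by (simp add: chain_boundary_diff)
    ultimately show "relcycle_mod s p X B c"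
      using zero_mod_boundary[OF d(2)] by (simp add: relcycle_mod_def)
  qed
  show "x - y \<in> Collect (relcycle_mod s p X B)"
    if "x \<in> Collect (relcycle_mod s p X B)" "y \<in> Collect (relcycle_mod s p X B)" for x y
    using that by (auto simp: relcycle_mod_def chain_boundary_diff intro: singular_chain_diff zero_mod_diff)
  show "0 \<in> Collect (relboundary_mod s p X B)"
    by (auto simp: relboundary_mod_def intro!: exI[of _ 0])
  show "x - y \<in> Collect (relboundary_mod s p X B)"
    if xy: "x \<in> Collect (relboundary_mod s p X B)" "y \<in> Collect (relboundary_mod s p X B)" for x y
  proof -
    obtain d d' where d: "singular_chain (Suc p) X d" "zero_mod s p X B (x - chain_boundary (Suc p) d)"
      "singular_chain (Suc p) X d'" "zero_mod s p X B (y - chain_boundary (Suc p) d')"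
      using xy by (auto simp: relboundary_mod_def)
    have "x - y - chain_boundary (Suc p) (d - d')
        = (x - chain_boundary (Suc p) d) - (y - chain_boundary (Suc p) d')"
      by (simp add: chain_boundary_diff)
    then show ?thesis
      using d singular_chain_diff zero_mod_diff unfolding relboundary_mod_def mem_Collect_eq by metis
  qed
qed

lemma zero_mod_zero: "zero_mod 0 p X B c \<longleftrightarrow> singular_chain p (subtopology X B) c"
  by (auto simp: zero_mod_def)

lemma relcycle_mod_0: "relcycle_mod 0 p X B = singular_relcycle p X B"
  by (auto simp: relcycle_mod_def zero_mod_zero singular_relcycle fun_eq_iff)

lemma relboundary_mod_0: "relboundary_mod 0 p X B = singular_relboundary p X B"
proof
  fix c
  \<comment> \<open>\<open>singular_relboundary\<close> takes the difference in the opposite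
    order.\<close>
  have "singular_chain p (subtopology X B) (c - d) = singular_chain p (subtopology X B) (d - c)" for d
    using singular_chain_minus[of p "subtopology X B" "d - c"] by simp
  then show "relboundary_mod 0 p X B c = singular_relboundary p X B c"
    by (simp add: relboundary_mod_def zero_mod_zero singular_relboundary_def mod_subset_def)
qed

text \<open>Reduction modulo 0 is no reduction, so integral homology is the case
  \<open>s = 0\<close> and both parts of the theorem can go through
  \<open>cubical_homology_iso\<close>.\<close>

lemma homology_mod_0: "homology_mod 0 p X B = relative_homology_group (int p) X B"
  by (simp add: homology_mod_def relative_homology_group_def relcycle_group_def relcycle_mod_0 relboundary_mod_0)

section \<open>Homology of the total complex\<close>

context cubical_weights
begin

definition tot_group :: "nat \<Rightarrow> 'a topology \<Rightarrow> 'a set \<Rightarrow> (nat \<Rightarrow> 'a chain) monoid" where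
  "tot_group n X B = \<lparr>carrier = Collect (tot_relcycle n X B), mult = (\<lambda>e e' k. e k + e' k), one = (\<lambda>_. 0)\<rparr>"

lemma tot_bd_add: "tot_bd n (\<lambda>k. e k + e' k) k = tot_bd n e k + tot_bd n e' k"
  by (simp add: tot_bd_def chain_boundary_add frag_cmul_distrib2)

lemma tot_bd_minus: "tot_bd n (\<lambda>k. - e k) k = - tot_bd n e k"
  by (rule poly_mapping_eqI) (simp add: tot_bd_def chain_boundary_minus lookup_add lookup_minus)

lemma group_tot_group: "group (tot_group n X B)"
proof (rule groupI)
  fix x assume "x \<in> carrier (tot_group n X B)"
  then have "tot_relcycle n X B (\<lambda>k. - x k)"
    by (auto simp: tot_group_def tot_relcycle_def tot_bd_minus singular_chain_minus)
  then show "\<exists>y\<in>carrier (tot_group n X B). y \<otimes>\<^bsub>tot_group n X B\<^esub> x = \<one>\<^bsub>tot_group n X B\<^esub>"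
    by (intro bexI[of _ "\<lambda>k. - x k"]) (auto simp: tot_group_def)
qed (auto simp: tot_group_def tot_relcycle_def tot_bd_add tot_bd_def[of n "\<lambda>_. 0"] add.assoc intro: singular_chain_add)

text \<open>What remains to be checked for each \<sigma> is pure algebra of the total complex: the
  projection to the components in \<open>I\<close> maps cycles onto families of cycles modulo
  \<open>s\<close>, and detects boundaries.\<close>

lemma cubical_homology_iso:
  assumes I: "I \<subseteq> {..n}"
    and cyc: "\<And>e k. tot_relcycle n X B e \<Longrightarrow> k \<in> I \<Longrightarrow> relcycle_mod s k X B (e k)"
    and onto: "\<And>c. (\<And>k. k \<in> I \<Longrightarrow> relcycle_mod s k X B (c k)) \<Longrightarrow> \<exists>e. tot_relcycle n X B e \<and> (\<forall>k\<in>I. e k = c k)"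
    and ker: "\<And>e. tot_relcycle n X B e \<Longrightarrow> tot_relboundary n X B e \<longleftrightarrow> (\<forall>k\<in>I. relboundary_mod s k X B (e k))"
  shows "cubical_homology a b n X B \<cong> sum_group I (\<lambda>k. homology_mod s k X B)"
proof -
  interpret C: frag_quotient "Collect (singular_cube n X)" "Collect (cube_relcycle a b n X B)" "Collect (cube_relboundary a b n X B)"
    by (rule frag_quotient_cube)
  interpret M: frag_quotient "singular_simplex_set k X" "Collect (relcycle_mod s k X B)" "Collect (relboundary_mod s k X B)" for k
    by (rule frag_quotient_mod)
  have Cq: "cubical_homology a b n X B = C.quot"
    by (simp add: cubical_homology_def cube_group_def)
  have Mq: "homology_mod s k X B = M.quot k" for k
    by (simp add: homology_mod_def chain_group_def)
  have fin: "finite I"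
    using I finite_subset by blast
  have grM: "group (homology_mod s k X B)" for k
    unfolding Mq by (rule M.group_quot)
  have carS: "carrier (sum_group I (\<lambda>k. homology_mod s k X B)) = (\<Pi>\<^sub>E k\<in>I. carrier (homology_mod s k X B))"
    using fin by (simp add: carrier_sum_group grM)
  define h1 where "h1 e = C.cls (tot_to_cube n e)" for e
  define h2 where "h2 e = (\<lambda>k\<in>I. M.cls k (e k))" for e
  show ?thesis
  proof (rule iso_of_common_source[of "tot_group n X B" _ _ h1 h2])
    show "group (tot_group n X B)"
      by (rule group_tot_group)
    show "group (cubical_homology a b n X B)"
      unfolding Cq by (rule C.group_quot)
    show "group (sum_group I (\<lambda>k. homology_mod s k X B))"
      by (simp add: grM)
    show "h1 \<in> hom (tot_group n X B) (cubical_homology a b n X B)"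
      unfolding Cq
      by (rule homI)
         (auto simp: tot_group_def h1_def C.carrier_quot tot_to_cube_add C.cls_add tot_to_cube_relcycle)
    show "h2 \<in> hom (tot_group n X B) (sum_group I (\<lambda>k. homology_mod s k X B))"
      by (rule homI)
         (auto simp: tot_group_def h2_def carS[unfolded Mq] Mq M.carrier_quot M.cls_add cyc cong: restrict_cong)
    show "h1 ` carrier (tot_group n X B) = carrier (cubical_homology a b n X B)"
    proof
      show "h1 ` carrier (tot_group n X B) \<subseteq> carrier (cubical_homology a b n X B)"
        unfolding Cq by (auto simp: tot_group_def h1_def C.carrier_quot intro!: tot_to_cube_relcycle)
      show "carrier (cubical_homology a b n X B) \<subseteq> h1 ` carrier (tot_group n X B)"
      proof
        fix y assume "y \<in> carrier (cubical_homology a b n X B)"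
        then obtain z where z: "y = C.cls z" "cube_relcycle a b n X B z"
          unfolding Cq C.carrier_quot by auto
        obtain e where "tot_relcycle n X B e" "cube_relboundary a b n X B (z - tot_to_cube n e)"
          using tot_to_cube_onto[OF z(2)] .
        then show "y \<in> h1 ` carrier (tot_group n X B)"
          using C.cls_eqI[of z "tot_to_cube n e"] z by (auto simp: h1_def tot_group_def)
      qed
    qed
    show "h2 ` carrier (tot_group n X B) = carrier (sum_group I (\<lambda>k. homology_mod s k X B))"
    proof
      show "h2 ` carrier (tot_group n X B) \<subseteq> carrier (sum_group I (\<lambda>k. homology_mod s k X B))"
        unfolding carS by (auto simp: tot_group_def h2_def Mq M.carrier_quot intro!: cyc)
      show "carrier (sum_group I (\<lambda>k. homology_mod s k X B)) \<subseteq> h2 ` carrier (tot_group n X B)"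
      proof
        fix y assume "y \<in> carrier (sum_group I (\<lambda>k. homology_mod s k X B))"
        then have "y \<in> (\<Pi>\<^sub>E k\<in>I. carrier (homology_mod s k X B))"
          by (simp only: carS)
        then have y: "y \<in> (\<Pi>\<^sub>E k\<in>I. M.cls k ` Collect (relcycle_mod s k X B))"
          by (simp only: Mq M.carrier_quot)
        then have "\<forall>k\<in>I. \<exists>c. relcycle_mod s k X B c \<and> y k = M.cls k c"
          by (fastforce simp: PiE_iff)
        then obtain c where c: "\<And>k. k \<in> I \<Longrightarrow> relcycle_mod s k X B (c k) \<and> y k = M.cls k (c k)"
          by metis
        then obtain e where e: "tot_relcycle n X B e" "\<forall>k\<in>I. e k = c k"
          using onto[of c] by blast
        then have "y = h2 e"
          using y c e(2) by (auto simp: h2_def PiE_iff extensional_def restrict_def fun_eq_iff)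
        then show "y \<in> h2 ` carrier (tot_group n X B)"
          using e by (simp add: tot_group_def)
      qed
    qed
    have "h1 e = \<one>\<^bsub>cubical_homology a b n X B\<^esub> \<longleftrightarrow> h2 e = \<one>\<^bsub>sum_group I (\<lambda>k. homology_mod s k X B)\<^esub>"
      if e: "tot_relcycle n X B e" for e
    proof -
      have "h1 e = \<one>\<^bsub>cubical_homology a b n X B\<^esub> \<longleftrightarrow> tot_relboundary n X B e"
        using C.cls_eq_one_iff[of "tot_to_cube n e"] tot_to_cube_relboundary_iff[OF e] by (simp add: Cq h1_def)
      moreover have "h2 e = \<one>\<^bsub>sum_group I (\<lambda>k. homology_mod s k X B)\<^esub> \<longleftrightarrow> (\<forall>k\<in>I. M.cls k (e k) = Collect (relboundary_mod s k X B))"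
        by (auto simp: h2_def Mq fun_eq_iff restrict_def)
      ultimately show ?thesis
        using ker[OF e] by (simp add: M.cls_eq_one_iff)
    qed
    then show "kernel (tot_group n X B) (cubical_homology a b n X B) h1
        = kernel (tot_group n X B) (sum_group I (\<lambda>k. homology_mod s k X B)) h2"
      by (auto simp: kernel_def tot_group_def)
  qed
qed

text \<open>The total differential is now the simplicial boundary in each component, so cycles and
  boundaries split; only the index shift between \<open>k\<close> and \<open>Suc k\<close> needs
  care.\<close>

lemma cubical_homology_sigma_0:
  assumes s: "a + b = 0"
  shows "cubical_homology a b n X B \<cong> sum_group {0..n} (\<lambda>k. homology_mod 0 k X B)"
proof (rule cubical_homology_iso)
  have tb: "tot_bd m e k = chain_boundary (Suc k) (e (Suc k))" for m k and e :: "nat \<Rightarrow> 'a chain"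
    by (simp add: tot_bd_def s)
  have zc: "tot_relcycle n X B e \<longleftrightarrow> (\<forall>k>n. e k = 0) \<and> (\<forall>k\<le>n. relcycle_mod 0 k X B (e k))" for e
  proof -
    have "(\<forall>k<n. P (Suc k)) \<longleftrightarrow> (\<forall>k\<le>n. k = 0 \<or> P k)" for P
    proof safe
      fix k assume "\<forall>k<n. P (Suc k)" "k \<le> n" "\<not> P k"
      then show "k = 0" by (cases k) auto
    next
      fix k assume "\<forall>k\<le>n. k = 0 \<or> P k" "k < n"
      then show "P (Suc k)" by (auto dest: spec[of _ "Suc k"])
    qed
    from this[of "\<lambda>k. singular_chain (k - 1) (subtopology X B) (chain_boundary k (e k))"]
    show ?thesis
      by (auto simp: tot_relcycle_def tb relcycle_mod_def zero_mod_zero chain_boundary_def[of 0])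
  qed
  show "relcycle_mod 0 k X B (e k)" if "tot_relcycle n X B e" "k \<in> {0..n}" for e k
    using that zc by auto
  show "\<exists>e. tot_relcycle n X B e \<and> (\<forall>k\<in>{0..n}. e k = c k)"
    if "\<And>k. k \<in> {0..n} \<Longrightarrow> relcycle_mod 0 k X B (c k)" for c
    using that zc by (intro exI[of _ "\<lambda>k. if k \<le> n then c k else 0"]) auto
  show "tot_relboundary n X B e \<longleftrightarrow> (\<forall>k\<in>{0..n}. relboundary_mod 0 k X B (e k))" if "tot_relcycle n X B e" for e
  proof
    assume "tot_relboundary n X B e"
    then show "\<forall>k\<in>{0..n}. relboundary_mod 0 k X B (e k)"
      by (force simp: tot_relboundary_def tb relboundary_mod_def zero_mod_zero)
  next
    assume "\<forall>k\<in>{0..n}. relboundary_mod 0 k X B (e k)"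
    then have "\<forall>k\<in>{0..n}. \<exists>d. singular_chain (Suc k) X d \<and> singular_chain k (subtopology X B) (e k - chain_boundary (Suc k) d)"
      by (simp add: relboundary_mod_def zero_mod_zero)
    then obtain d where "\<And>k. k \<le> n \<Longrightarrow> singular_chain (Suc k) X (d k) \<and> singular_chain k (subtopology X B) (e k - chain_boundary (Suc k) (d k))"
      by (metis atLeastAtMost_iff le0)
    \<comment> \<open>Component \<open>k\<close> is bounded by component \<open>Suc k\<close> of the
      witness, hence the shift; component 0 bounds nothing and is set to 0.\<close>
    then show "tot_relboundary n X B e"
      unfolding tot_relboundary_def tb
      by (intro exI[of _ "\<lambda>k. if k = 0 then 0 else d (k - 1)"]) (auto simp: le_Suc_eq Suc_le_eq gr0_conv_Suc)
  qed
qed auto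

text \<open>The total complex decomposes into pieces joining a component \<open>k\<close> with
  \<open>n - k\<close> even to component \<open>k - 1\<close> through \<sigma>. The cycle condition
  makes the even components cycles modulo \<sigma>, and the others their boundaries divided by
  \<sigma>, up to sign and chains of \<open>B\<close>.\<close>

lemma cubical_homology_sigma_nonzero:
  assumes s: "a + b \<noteq> 0"
  shows "cubical_homology a b n X B \<cong> sum_group {k. k \<le> n \<and> even (n - k)} (\<lambda>k. homology_mod (a + b) k X B)"
proof (rule cubical_homology_iso)
  let ?s = "a + b" and ?I = "{k. k \<le> n \<and> even (n - k)}" and ?B = "subtopology X B"
  have eps: "(-1) ^ k * ?s * (-1) ^ k = ?s" for k
    by (simp add: minus_one_power_iff)
  have dist: "p * q * E + p * q * p * V = q * p * (E - - p * V)" for p q E V :: int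
    by (simp add: algebra_simps)
  show "relcycle_mod ?s k X B (e k)" if e: "tot_relcycle n X B e" and k: "k \<in> ?I" for e k
  proof (cases k)
    case 0
    then show ?thesis
      using e by (simp add: tot_relcycle_def relcycle_mod_def chain_boundary_def)
  next
    case (Suc j)
    have "odd (n - j)"
      using k Suc by (auto simp: Suc_diff_Suc[symmetric])
    moreover have "singular_chain j ?B (tot_bd n e j)"
      using e k Suc by (auto simp: tot_relcycle_def)
    ultimately have "singular_chain j ?B (chain_boundary k (e k) + frag_cmul ((-1) ^ j * ?s) (e j))"
      using Suc by (simp add: tot_bd_def)
    moreover have "singular_chain j X (frag_cmul (- ((-1) ^ j)) (e j))"
      using e k Suc by (auto simp: tot_relcycle_def intro: singular_chain_cmul)
    ultimately have "zero_mod ?s j X B (chain_boundary k (e k))"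
      unfolding zero_mod_def
      by (intro exI[of _ "chain_boundary k (e k) + frag_cmul ((-1) ^ j * ?s) (e j)"] exI[of _ "frag_cmul (- ((-1) ^ j)) (e j)"])
         (auto intro!: poly_mapping_eqI simp: lookup_add algebra_simps)
    then show ?thesis
      using e k Suc by (simp add: relcycle_mod_def tot_relcycle_def)
  qed
  show "\<exists>e. tot_relcycle n X B e \<and> (\<forall>k\<in>?I. e k = c k)"
    if c: "\<And>k. k \<in> ?I \<Longrightarrow> relcycle_mod ?s k X B (c k)" for c
  proof -
    have "\<forall>k\<in>?I. \<exists>u v. singular_chain (k - 1) ?B u \<and> singular_chain (k - 1) X v \<and> chain_boundary k (c k) = u + frag_cmul ?s v"
      using c by (auto simp: relcycle_mod_def zero_mod_def)
    then obtain u v where uv: "\<And>k. k \<in> ?I \<Longrightarrow> singular_chain (k - 1) ?B (u k) \<and> singular_chain (k - 1) X (v k)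
        \<and> chain_boundary k (c k) = u k + frag_cmul ?s (v k)"
      by metis
    \<comment> \<open>For \<open>n - k\<close> odd the value is forced: it must cancel the part of
      the boundary of \<open>c (Suc k)\<close> that is divisible by \<sigma>, leaving
      \<open>u (Suc k)\<close>, a chain of \<open>B\<close>.\<close>
    define e where "e k = (if k \<le> n then if even (n - k) then c k else frag_cmul (- ((-1) ^ k)) (v (Suc k)) else 0)" for k
    have "singular_chain k X (e k)" if "k \<le> n" for k
    proof (cases "even (n - k)")
      case True
      then show ?thesis using c[of k] that by (auto simp: e_def relcycle_mod_def)
    next
      case False
      then have "Suc k \<in> ?I"
        using that by (cases "k = n") (auto simp: Suc_diff_Suc[symmetric])
      then show ?thesis using uv[of "Suc k"] that False by (auto simp: e_def intro: singular_chain_cmul)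
    qed
    moreover have "singular_chain k ?B (tot_bd n e k)" if k: "k < n" for k
    proof (cases "even (n - k)")
      case False
      then have I: "Suc k \<in> ?I"
        using k by (auto simp: Suc_diff_Suc[symmetric])
      then have "tot_bd n e k = u (Suc k)"
        using uv[OF I] k False by (intro poly_mapping_eqI) (auto simp: tot_bd_def e_def lookup_add)
      then show ?thesis
        using uv[OF I] by simp
    next
      case True
      then have I: "Suc (Suc k) \<in> ?I" and odd: "odd (n - Suc k)"
        using k by (cases "Suc k = n"; auto simp: Suc_diff_Suc[symmetric])+
      let ?v = "v (Suc (Suc k))" and ?u = "u (Suc (Suc k))"
      \<comment> \<open>The other half of the cycle condition: since the boundary squares to 0,
        \<sigma> times the boundary of \<open>?v\<close> is a chain of \<open>B\<close>, and
        \<sigma> may be cancelled.\<close>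
      have "chain_boundary (Suc k) (chain_boundary (Suc (Suc k)) (c (Suc (Suc k)))) = 0"
        using c[OF I] by (auto simp: relcycle_mod_def intro: chain_boundary_boundary_alt)
      then have "frag_cmul ?s (chain_boundary (Suc k) ?v) = - chain_boundary (Suc k) ?u"
        using uv[OF I] by (simp add: chain_boundary_add chain_boundary_cmul eq_neg_iff_add_eq_0 add.commute)
      moreover have "singular_chain k ?B (chain_boundary (Suc k) ?u)"
        using uv[OF I] by (auto intro: singular_chain_boundary_alt)
      ultimately have "singular_chain k ?B (chain_boundary (Suc k) ?v)"
        using s by (metis singular_chain_frag_cmulD singular_chain_minus)
      then show ?thesis
        using True odd k by (simp add: tot_bd_def e_def chain_boundary_cmul singular_chain_cmul)
    qed
    ultimately have "tot_relcycle n X B e"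
      by (auto simp: tot_relcycle_def e_def)
    then show ?thesis
      by (intro exI[of _ e]) (auto simp: e_def)
  qed
  show "tot_relboundary n X B e \<longleftrightarrow> (\<forall>k\<in>?I. relboundary_mod ?s k X B (e k))" if e: "tot_relcycle n X B e" for e
  proof
    assume "tot_relboundary n X B e"
    then obtain e' where e': "\<And>k. k \<le> Suc n \<Longrightarrow> singular_chain k X (e' k)"
      "\<And>k. k \<le> n \<Longrightarrow> singular_chain k ?B (e k - tot_bd (Suc n) e' k)"
      by (auto simp: tot_relboundary_def)
    show "\<forall>k\<in>?I. relboundary_mod ?s k X B (e k)"
    proof
      fix k assume k: "k \<in> ?I"
      then have "tot_bd (Suc n) e' k = chain_boundary (Suc k) (e' (Suc k)) + frag_cmul ((-1) ^ k * ?s) (e' k)"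
        by (auto simp: tot_bd_def Suc_diff_le)
      then have "zero_mod ?s k X B (e k - chain_boundary (Suc k) (e' (Suc k)))"
        unfolding zero_mod_def using e'(1)[of k] e'(2)[of k] k
        by - (rule exI[of _ "e k - tot_bd (Suc n) e' k"], rule exI[of _ "frag_cmul ((-1) ^ k) (e' k)"],
            simp add: singular_chain_cmul mult.commute)
      then show "relboundary_mod ?s k X B (e k)"
        unfolding relboundary_mod_def using e'(1)[of "Suc k"] k by auto
    qed
  next
    assume "\<forall>k\<in>?I. relboundary_mod ?s k X B (e k)"
    then have "\<forall>k\<in>?I. \<exists>d. singular_chain (Suc k) X d \<and> zero_mod ?s k X B (e k - chain_boundary (Suc k) d)"
      by (simp only: relboundary_mod_def)
    from bchoice[OF this] obtain d where d: "\<forall>k\<in>?I. singular_chain (Suc k) X (d k) \<and> zero_mod ?s k X B (e k - chain_boundary (Suc k) (d k))"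
      by blast
    then have "\<forall>k\<in>?I. \<exists>u. \<exists>v. singular_chain k ?B u \<and> singular_chain k X v
        \<and> e k - chain_boundary (Suc k) (d k) = u + frag_cmul ?s v"
      by (simp only: zero_mod_def) blast
    from bchoice[OF this] obtain u where "\<forall>k\<in>?I. \<exists>v. singular_chain k ?B (u k) \<and> singular_chain k X v
        \<and> e k - chain_boundary (Suc k) (d k) = u k + frag_cmul ?s v"
      by blast
    from bchoice[OF this] obtain v where "\<forall>k\<in>?I. singular_chain k ?B (u k) \<and> singular_chain k X (v k)
        \<and> e k - chain_boundary (Suc k) (d k) = u k + frag_cmul ?s (v k)"
      by blast
    with d have duv: "\<And>k. k \<in> ?I \<Longrightarrow> singular_chain (Suc k) X (d k) \<and> singular_chain k ?B (u k) \<and> singular_chain k X (v k)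
        \<and> e k - chain_boundary (Suc k) (d k) = u k + frag_cmul ?s (v k)"
      by blast
    \<comment> \<open>For \<open>n - k\<close> even, the total boundary in component
      \<open>k\<close> becomes the boundary of \<open>d k\<close> plus \<sigma> times
      \<open>v k\<close>, as the two factors \<open>(-1) ^ k\<close> multiply to 1.\<close>
    define e' where "e' k = (if even (Suc n - k) then if k = 0 then 0 else d (k - 1) else frag_cmul ((-1) ^ k) (v k))" for k
    have "singular_chain k X (e' k)" if "k \<le> Suc n" for k
    proof (cases "even (Suc n - k)")
      case True
      then show ?thesis
        using duv[of "k - 1"] that by (cases k) (auto simp: e'_def)
    next
      case False
      then have "k \<in> ?I"
        using that by (cases "k = Suc n") (auto simp: Suc_diff_le)
      then show ?thesis
        using duv[of k] False by (auto simp: e'_def intro: singular_chain_cmul)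
    qed
    moreover have "singular_chain k ?B (e k - tot_bd (Suc n) e' k)" if k: "k \<le> n" for k
    proof (cases "even (n - k)")
      case True
      then have I: "k \<in> ?I" and "odd (Suc n - k)"
        using k by (auto simp: Suc_diff_le)
      then have "e k - tot_bd (Suc n) e' k = e k - chain_boundary (Suc k) (d k) - frag_cmul ?s (v k)"
        using True by (simp add: tot_bd_def e'_def eps)
      also have "\<dots> = u k"
        using duv[OF I] by simp
      finally show ?thesis
        using duv[OF I] by simp
    next
      case False
      then have "k < n" and I: "Suc k \<in> ?I" and ev: "even (Suc n - k)"
        using k by (cases "k = n"; auto simp: Suc_diff_le Suc_diff_Suc[symmetric])+
      let ?d = "d (Suc k)" and ?u = "u (Suc k)" and ?v = "v (Suc k)"
      \<comment> \<open>Nothing was chosen for the components with \<open>n - k\<close> odd. There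
        the required relation is first obtained multiplied by \<sigma> and a sign, from the cycle
        condition on \<open>e\<close> and this formula for \<open>e (Suc k)\<close>, and then
        divided.\<close>
      have eS: "e (Suc k) = chain_boundary (Suc (Suc k)) ?d + (?u + frag_cmul ?s ?v)"
        using duv[OF I] by (simp add: algebra_simps)
      have "chain_boundary (Suc k) (e (Suc k)) = chain_boundary (Suc k) ?u + frag_cmul ?s (chain_boundary (Suc k) ?v)"
        unfolding eS using duv[OF I] chain_boundary_boundary_alt[of "Suc k" X ?d]
        by (simp add: chain_boundary_add chain_boundary_cmul)
      moreover have "singular_chain k ?B (tot_bd n e k)"
        using e \<open>k < n\<close> by (simp add: tot_relcycle_def)
      ultimately have "singular_chain k ?B (chain_boundary (Suc k) ?u + frag_cmul ?s (chain_boundary (Suc k) ?v) + frag_cmul ((-1) ^ k * ?s) (e k))"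
        using False by (simp add: tot_bd_def)
      moreover have "singular_chain k ?B (chain_boundary (Suc k) ?u)"
        using duv[OF I] by (auto intro: singular_chain_boundary_alt)
      ultimately have sc: "singular_chain k ?B (chain_boundary (Suc k) ?u + frag_cmul ?s (chain_boundary (Suc k) ?v)
           + frag_cmul ((-1) ^ k * ?s) (e k) - chain_boundary (Suc k) ?u)"
        by (rule singular_chain_diff)
      have eq: "chain_boundary (Suc k) ?u + frag_cmul ?s (chain_boundary (Suc k) ?v)
           + frag_cmul ((-1) ^ k * ?s) (e k) - chain_boundary (Suc k) ?u
         = frag_cmul (?s * (-1) ^ k) (e k - tot_bd (Suc n) e' k)"
        (is "?l = ?r")
      proof (rule poly_mapping_eqI)
        fix x
        define E V U where "E = Poly_Mapping.lookup (e k) x" and "V = Poly_Mapping.lookup (chain_boundary (Suc k) ?v) x"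
          and "U = Poly_Mapping.lookup (chain_boundary (Suc k) ?u) x"
        have tb: "tot_bd (Suc n) e' k = frag_cmul (- ((-1) ^ k)) (chain_boundary (Suc k) ?v)"
          using ev False by (simp add: tot_bd_def e'_def chain_boundary_cmul)
        have "Poly_Mapping.lookup ?l x = (-1) ^ k * ?s * E + ?s * V"
          by (simp only: lookup_add lookup_minus lookup_frag_cmul flip: E_def V_def U_def)
        also have "\<dots> = (-1) ^ k * ?s * E + (-1) ^ k * ?s * (-1) ^ k * V"
          by (simp only: eps)
        also have "\<dots> = ?s * (-1) ^ k * (E - - ((-1) ^ k) * V)"
          by (rule dist)
        also have "\<dots> = Poly_Mapping.lookup ?r x"
          by (simp only: tb lookup_add lookup_minus lookup_frag_cmul flip: E_def V_def)
        finally show "Poly_Mapping.lookup ?l x = Poly_Mapping.lookup ?r x" .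
      qed
      have "?s * (-1) ^ k \<noteq> 0"
        using s by simp
      then show ?thesis
        by (rule singular_chain_frag_cmulD[OF sc[unfolded eq]])
    qed
    ultimately show "tot_relboundary n X B e"
      unfolding tot_relboundary_def by blast
  qed
qed auto

end

theorem theorem4:
  fixes a b :: int and X :: "'a topology" and B :: "'a set" and n :: nat
  assumes "gcd a b = 1"
    and "finite_CW_pair X B"
  shows "({a, b} = {1, -1} \<longrightarrow>
            cubical_homology a b n X B \<cong>
              sum_group {0..n} (\<lambda>k. relative_homology_group (int k) X B))
       \<and> ({a, b} \<noteq> {1, -1} \<longrightarrow>
            (even n \<longrightarrow> cubical_homology a b n X B \<cong>
               sum_group {k. k \<le> n \<and> even k} (\<lambda>k. homology_mod (a + b) k X B))
          \<and> (odd n \<longrightarrow> cubical_homology a b n X B \<cong>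
               sum_group {k. k \<le> n \<and> odd k} (\<lambda>k. homology_mod (a + b) k X B)))"
proof -
  \<comment> \<open>Bezout for \<open>b\<close> and \<sigma> produces the coefficients of \<theta>;
    the locale parameter \<open>t\<close> is minus the second coefficient.\<close>
  have "gcd b (a + b) = 1"
    using assms(1) by (metis gcd.commute gcd_add1)
  then obtain u v where "u * b + v * (a + b) = 1"
    using bezout_int[of b "a + b"] by auto
  then interpret cubical_weights a b u "- v"
    by unfold_locales (simp add: algebra_simps)
  \<comment> \<open>If \<sigma> = 0 then the gcd of \<open>a\<close> and \<open>b\<close> is the
    absolute value of \<open>a\<close>, which must be 1.\<close>
  have pm: "{a, b} = {1, -1} \<longleftrightarrow> a + b = 0"
  proof
    assume "a + b = 0"
    then have "b = - a" by simp
    then have "\<bar>a\<bar> = 1" using assms(1) by simp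
    then show "{a, b} = {1, -1}"
      using \<open>b = - a\<close> by (auto simp: abs_if split: if_splits)
  qed (auto simp: doubleton_eq_iff)
  have ev: "{k. k \<le> n \<and> even (n - k)} = {k. k \<le> n \<and> (even k \<longleftrightarrow> even n)}"
    by (auto simp: even_diff_nat)
  show ?thesis
  proof (cases "a + b = 0")
    case True
    then show ?thesis
      using cubical_homology_sigma_0[OF True, of n X B] pm by (simp only: homology_mod_0) blast
  next
    case False
    note iso = cubical_homology_sigma_nonzero[OF False, of n X B, unfolded ev]
    have "{a, b} \<noteq> {1, -1}"
      using False pm by blast
    then show ?thesis
      using iso by (cases "even n") simp_all
  qed
qed

end
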